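(* Let $n\in\mathbb{N}$ and let $M\subset\mathbb{R}^n$ be a subset that is not porous in $\mathbb{R}^n$. Then the Banach space $\mathrm{Lip}_0(M)$ is linearly isomorphic to $\mathrm{Lip}_0(\mathbb{R}^n)$.
   Context: $\mathbb{R}^n$ carries its Euclidean (norm) metric, and subsets carry the restricted metric. $B(p,r)$ denotes the closed ball with center $p$ and radius $r>0$. Porous: a subset $M$ of a metric space $X$ is porous (in $X$) if there exists $\lambda>0$ such that for every $p\in X$ and every $r$ with $0<r\leq\mathrm{diam}(X)$ (so, for $X=\mathbb{R}^n$, every $r>0$) there exists $x\in X$ with $B(x,\lambda r)\subset B(p,r)\setminus M$. Lipschitz space: for a metric space $(X,d)$ with a chosen base point $0\in X$, $\mathrm{Lip}_0(X)$ is the Banach space of all Lipschitz functions $f:X\to\mathbb{R}$ with $f(0)=0$, with norm $\|f\|_L=\sup\{\frac{f(x)-f(y)}{d(x,y)}: x\neq y\in X\}$. Different choices of base point give linearly isometric spaces, so the base point (which is any point of the metric space in question) is irrelevant here. "Linearly isomorphic" means that there is a bounded linear bijection with bounded inverse. *)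

theory Defs
  imports "HOL-Analysis.Analysis"
begin

(* Extended-real valued, since the library's "diameter" is an unspecified real number
   on unbounded sets. *)
definition ediameter :: "'a::metric_space set \<Rightarrow> ereal" where
  "ediameter X = (SUP x\<in>X. SUP y\<in>X. ereal (dist x y))"

(* The metric space is a set X with the restricted metric, so its closed balls are
   the sets cball p r \<inter> X. *)
definition porous_in :: "'a::metric_space set \<Rightarrow> 'a set \<Rightarrow> bool" where
  "porous_in X M \<longleftrightarrow>
     (\<exists>c>0. \<forall>p\<in>X. \<forall>r. 0 < r \<and> ereal r \<le> ediameter X \<longrightarrow>
        (\<exists>x\<in>X. cball x (c * r) \<inter> X \<subseteq> (cball p r \<inter> X) - M))"

(* The functions X \<rightarrow> \<real> are represented by total functions that vanish off X, so that
   distinct elements differ on X and the pointwise operations preserve Lip0 X a. *)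
definition Lip0 :: "'a::metric_space set \<Rightarrow> 'a \<Rightarrow> ('a \<Rightarrow> real) set" where
  "Lip0 X a = {f. (\<exists>C. C-lipschitz_on X f) \<and> f a = 0 \<and> (\<forall>x. x \<notin> X \<longrightarrow> f x = 0)}"

(* Swapping x and y shows that the quotients have supremum \<ge> 0 whenever there are any;
   inserting 0 only serves to give a one-point space norm 0. *)
definition lip_norm :: "'a::metric_space set \<Rightarrow> ('a \<Rightarrow> real) \<Rightarrow> real" where
  "lip_norm X f = Sup (insert 0 {(f x - f y) / dist x y | x y. x \<in> X \<and> y \<in> X \<and> x \<noteq> y})"

(* V and W are linear spaces of real functions under the pointwise operations, normed by
   p and q. *)
definition linearly_isomorphic ::
  "('a \<Rightarrow> real) set \<Rightarrow> (('a \<Rightarrow> real) \<Rightarrow> real) \<Rightarrow> ('b \<Rightarrow> real) set \<Rightarrow> (('b \<Rightarrow> real) \<Rightarrow> real) \<Rightarrow> bool"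
where
  "linearly_isomorphic V p W q \<longleftrightarrow>
     (\<exists>T. bij_betw T V W \<and>
          (\<forall>f\<in>V. \<forall>g\<in>V. T (\<lambda>x. f x + g x) = (\<lambda>y. T f y + T g y)) \<and>
          (\<forall>c. \<forall>f\<in>V. T (\<lambda>x. c * f x) = (\<lambda>y. c * T f y)) \<and>
          (\<exists>C. \<forall>f\<in>V. q (T f) \<le> C * p f) \<and>
          (\<exists>C. \<forall>g\<in>W. p (inv_into V T g) \<le> C * q g))"

lemma ediameter_UNIV: "ediameter (UNIV :: (real^'n) set) = \<infinity>"
proof -
  have "ereal r \<le> ediameter (UNIV :: (real^'n) set)" for r :: real
  proof -
    obtain x :: "real^'n" where x: "norm x = max r 0"
      by (metis max.cobounded2 vector_choose_size)
    have "ereal r \<le> ereal (dist x 0)" by (simp add: x)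
    also have "\<dots> \<le> (SUP y. ereal (dist x y))" by (rule SUP_upper) simp
    also have "\<dots> \<le> (SUP x::real^'n. SUP y. ereal (dist x y))"
      by (rule SUP_upper[where f = "\<lambda>x. SUP y. ereal (dist x y)"]) simp
    finally show ?thesis by (simp add: ediameter_def)
  qed
  then show ?thesis by (rule ereal_top)
qed

lemma porous_in_UNIV_iff:
  "porous_in UNIV (M :: (real^'n) set) \<longleftrightarrow>
     (\<exists>c>0. \<forall>p. \<forall>r>0. \<exists>x. cball x (c * r) \<subseteq> cball p r - M)"
  by (simp add: porous_in_def ediameter_UNIV)

lemma Lip0_add: "f \<in> Lip0 X a \<Longrightarrow> g \<in> Lip0 X a \<Longrightarrow> (\<lambda>x. f x + g x) \<in> Lip0 X a"
  unfolding Lip0_def by (auto intro: lipschitz_on_add)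

lemma Lip0_cmult: "f \<in> Lip0 X a \<Longrightarrow> (\<lambda>x. c * f x) \<in> Lip0 X a"
  unfolding Lip0_def by (auto intro: lipschitz_on_cmult_real)

lemma lip_norm_upper:
  assumes f: "f \<in> Lip0 X a" and xy: "x \<in> X" "y \<in> X" "x \<noteq> y"
  shows "(f x - f y) / dist x y \<le> lip_norm X f"
proof -
  obtain C where C: "C-lipschitz_on X f" using f by (auto simp: Lip0_def)
  have *: "(f u - f v) / dist u v \<le> C" if "u \<in> X" "v \<in> X" "u \<noteq> v" for u v
    using lipschitz_onD[OF C that(1,2)] that(3) by (simp add: divide_simps dist_real_def)
  have "bdd_above (insert 0 {(f x - f y) / dist x y | x y. x \<in> X \<and> y \<in> X \<and> x \<noteq> y})"
    using * by (auto intro!: bdd_aboveI[where M = C])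
  then show ?thesis unfolding lip_norm_def using xy by (intro cSup_upper) auto
qed

end

(* Let X = Lip0 of R^n and let Z be the l-infinity sum of countably many copies of X. By
   Pelczynski's decomposition method, a space Y is isomorphic to Z as soon as each of Y and Z is
   isomorphic to a complemented subspace of the other. This is applied to Y = Lip0 M for the given
   set M and for M = R^n, which is not porous either; so both spaces are isomorphic to Z.

   Lip0 M is complemented in X, hence in Z, because Lipschitz functions on a subset of R^n extend
   linearly, by averaging over a Whitney-type net whose mesh at x is comparable to the distance
   from x to M.

   Conversely, if M is not porous, there are pairwise disjoint balls in which M is
   denser and denser relative to the radius. A sequence of functions on R^n is encoded in one
   function on M by writing truncated scaled copies of each of them into infinitely many of the
   balls, and it is recovered by a generalized limit of the blow-ups at the centres. *)

theory Submission
  imports Defs "HOL-Library.Function_Algebras" "HOL-Library.Nat_Bijection"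
begin

section \<open>Bounded operators between function spaces\<close>

text \<open>Non-porosity supplies a dense ball for every accuracy but does not say where: balls of
  increasing accuracy may all overlap, and functions written into overlapping balls would interfere.
  Making the balls disjoint is the geometric core. A single ball shows a function only on a bounded
  region and with finite precision, so each component is repeated in infinitely many balls of
  growing resolution. The blow-ups of an arbitrary Lipschitz function on M need not converge along
  them, and passing to a subsequence that depends on the function would destroy linearity. A
  generalized limit is linear, is defined for all bounded sequences and keeps uniform bounds. Such
  bounds are all that is known about the recovered components, which is why the sum is an l-infinity
  sum. The same device serves the extension operator: the mesh is kept above a positive \<epsilon>,
  which avoids its degeneration on M, and the generalized limit is taken as \<epsilon> tends to
  0.\<close>

definition fun_space :: "('a \<Rightarrow> real) set \<Rightarrow> (('a \<Rightarrow> real) \<Rightarrow> real) \<Rightarrow> bool" where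
  "fun_space V p \<longleftrightarrow> 0 \<in> V \<and> (\<forall>f\<in>V. \<forall>g\<in>V. f + g \<in> V \<and> p (f + g) \<le> p f + p g) \<and>
     (\<forall>c. \<forall>f\<in>V. (\<lambda>x. c * f x) \<in> V \<and> p (\<lambda>x. c * f x) = \<bar>c\<bar> * p f) \<and> (\<forall>f\<in>V. 0 \<le> p f)"

definition bounded_op ::
  "real \<Rightarrow> ('a \<Rightarrow> real) set \<Rightarrow> (('a \<Rightarrow> real) \<Rightarrow> real) \<Rightarrow> ('b \<Rightarrow> real) set \<Rightarrow> (('b \<Rightarrow> real) \<Rightarrow> real)
    \<Rightarrow> (('a \<Rightarrow> real) \<Rightarrow> 'b \<Rightarrow> real) \<Rightarrow> bool" where
  "bounded_op K V p W q T \<longleftrightarrow> 0 \<le> K \<and> (\<forall>f\<in>V. T f \<in> W \<and> q (T f) \<le> K * p f) \<and>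
     (\<forall>f\<in>V. \<forall>g\<in>V. T (f + g) = T f + T g) \<and>
     (\<forall>c. \<forall>f\<in>V. T (\<lambda>x. c * f x) = (\<lambda>y. c * T f y))"

definition isomorphic_spaces ::
  "('a \<Rightarrow> real) set \<Rightarrow> (('a \<Rightarrow> real) \<Rightarrow> real) \<Rightarrow> ('b \<Rightarrow> real) set \<Rightarrow> (('b \<Rightarrow> real) \<Rightarrow> real) \<Rightarrow> bool" where
  "isomorphic_spaces V p W q \<longleftrightarrow> (\<exists>T U K L. bounded_op K V p W q T \<and> bounded_op L W q V p U \<and>
     (\<forall>f\<in>V. U (T f) = f) \<and> (\<forall>g\<in>W. T (U g) = g))"

lemma fun_spaceD:
  assumes "fun_space V p"
  shows "0 \<in> V" "f \<in> V \<Longrightarrow> g \<in> V \<Longrightarrow> f + g \<in> V" "f \<in> V \<Longrightarrow> g \<in> V \<Longrightarrow> p (f + g) \<le> p f + p g"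
    "f \<in> V \<Longrightarrow> (\<lambda>x. c * f x) \<in> V" "f \<in> V \<Longrightarrow> p (\<lambda>x. c * f x) = \<bar>c\<bar> * p f" "f \<in> V \<Longrightarrow> 0 \<le> p f"
  using assms by (auto simp: fun_space_def)

text \<open>An upper bound for scaling suffices: applied to the scaled function with the inverse
  scalar, it yields the reverse inequality.\<close>

lemma fun_spaceI:
  assumes "0 \<in> V" "\<And>f g. f \<in> V \<Longrightarrow> g \<in> V \<Longrightarrow> f + g \<in> V \<and> p (f + g) \<le> p f + p g"
    and scale: "\<And>c f. f \<in> V \<Longrightarrow> (\<lambda>x. c * f x) \<in> V \<and> p (\<lambda>x. c * f x) \<le> \<bar>c\<bar> * p f"
    and nonneg: "\<And>f. f \<in> V \<Longrightarrow> 0 \<le> p f"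
  shows "fun_space V p"
proof -
  have "p (\<lambda>x. c * f x) = \<bar>c\<bar> * p f" if f: "f \<in> V" for c f
  proof (cases "c = 0")
    case True
    then show ?thesis using scale[OF f, of c] nonneg by force
  next
    case False
    have "p (\<lambda>x. inverse c * (c * f x)) \<le> \<bar>inverse c\<bar> * p (\<lambda>x. c * f x)"
      using scale[OF f, of c] scale by blast
    then have "\<bar>c\<bar> * p f \<le> p (\<lambda>x. c * f x)"
      using False by (simp add: field_simps abs_inverse)
    then show ?thesis using scale[OF f, of c] by simp
  qed
  then show ?thesis using assms unfolding fun_space_def by blast
qed

lemma fun_space_diff:
  assumes V: "fun_space V p" and f: "f \<in> V" and g: "g \<in> V"
  shows "f - g \<in> V" "p (f - g) \<le> p f + p g"
proof -
  have eq: "f - g = f + (\<lambda>x. - 1 * g x)" by (auto simp: fun_eq_iff)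
  show "f - g \<in> V" unfolding eq by (intro fun_spaceD[OF V] f g)
  show "p (f - g) \<le> p f + p g"
    unfolding eq using fun_spaceD(3)[OF V f fun_spaceD(4)[OF V g, of "- 1"]]
    fun_spaceD(5)[OF V g, of "- 1"] by simp
qed

lemma bounded_opD:
  assumes "bounded_op K V p W q T"
  shows "0 \<le> K" "f \<in> V \<Longrightarrow> T f \<in> W" "f \<in> V \<Longrightarrow> q (T f) \<le> K * p f"
    "f \<in> V \<Longrightarrow> g \<in> V \<Longrightarrow> T (f + g) = T f + T g" "f \<in> V \<Longrightarrow> T (\<lambda>x. c * f x) = (\<lambda>y. c * T f y)"
  using assms by (auto simp: bounded_op_def)

lemma bounded_op_diff:
  assumes V: "fun_space V p" and T: "bounded_op K V p W q T" and f: "f \<in> V" and g: "g \<in> V"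
  shows "T (f - g) = T f - T g"
proof -
  have "T f = T ((f - g) + g)" by simp
  also have "\<dots> = T (f - g) + T g"
    by (intro bounded_opD(4)[OF T] fun_space_diff[OF V] f g)
  finally show ?thesis by simp
qed

lemma bounded_op_id: "bounded_op 1 V p V p (\<lambda>f. f)"
  by (simp add: bounded_op_def)

lemma bounded_op_comp:
  assumes "bounded_op L W q X r U" "bounded_op K V p W q T"
  shows "bounded_op (L * K) V p X r (\<lambda>f. U (T f))"
proof -
  have "r (U (T f)) \<le> L * K * p f" if "f \<in> V" for f
  proof -
    have "r (U (T f)) \<le> L * q (T f)" using assms that by (auto simp: bounded_op_def)
    also have "\<dots> \<le> L * (K * p f)"
      using assms that by (intro mult_left_mono) (auto simp: bounded_op_def)
    finally show ?thesis by (simp add: mult.assoc)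
  qed
  then show ?thesis using assms by (auto simp: bounded_op_def)
qed

lemma bounded_op_add:
  assumes W: "fun_space W q" and T: "bounded_op K V p W q T" and U: "bounded_op L V p W q U"
  shows "bounded_op (K + L) V p W q (\<lambda>f. T f + U f)"
  unfolding bounded_op_def
proof (intro conjI ballI allI)
  show "0 \<le> K + L" using bounded_opD(1)[OF T] bounded_opD(1)[OF U] by simp
next
  fix f assume f: "f \<in> V"
  show "T f + U f \<in> W" using bounded_opD(2)[OF T f] bounded_opD(2)[OF U f] fun_spaceD(2)[OF W] by blast
  show "q (T f + U f) \<le> (K + L) * p f"
    using fun_spaceD(3)[OF W bounded_opD(2)[OF T f] bounded_opD(2)[OF U f]]
      bounded_opD(3)[OF T f] bounded_opD(3)[OF U f] by (simp add: algebra_simps)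
next
  fix f g assume "f \<in> V" "g \<in> V"
  then show "T (f + g) + U (f + g) = T f + U f + (T g + U g)"
    by (simp add: bounded_opD(4)[OF T] bounded_opD(4)[OF U])
next
  fix c f assume "f \<in> V"
  then show "T (\<lambda>x. c * f x) + U (\<lambda>x. c * f x) = (\<lambda>y. c * (T f + U f) y)"
    by (simp add: bounded_opD(5)[OF T] bounded_opD(5)[OF U] fun_eq_iff algebra_simps)
qed

lemma bounded_op_minus:
  assumes W: "fun_space W q" and T: "bounded_op K V p W q T" and U: "bounded_op L V p W q U"
  shows "bounded_op (K + L) V p W q (\<lambda>f. T f - U f)"
proof -
  have neg: "bounded_op 1 W q W q (\<lambda>f x. - 1 * f x)"
    using fun_spaceD(4)[OF W, of _ "- 1"] fun_spaceD(5)[OF W, of _ "- 1"]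
    by (simp add: bounded_op_def fun_eq_iff)
  have "(\<lambda>f. T f - U f) = (\<lambda>f. T f + (\<lambda>x. - 1 * U f x))" by (simp add: fun_eq_iff)
  then show ?thesis using bounded_op_add[OF W T bounded_op_comp[OF neg U]] by simp
qed

lemma bounded_op_mono:
  assumes T: "bounded_op K V p W q T" and "K \<le> L" and V: "fun_space V p"
  shows "bounded_op L V p W q T"
proof -
  have "q (T f) \<le> L * p f" if "f \<in> V" for f
    using bounded_opD(3)[OF T that] mult_right_mono[OF \<open>K \<le> L\<close> fun_spaceD(6)[OF V that]] by linarith
  then show ?thesis using T \<open>K \<le> L\<close> by (auto simp: bounded_op_def)
qed

lemma isomorphic_spaces_sym: "isomorphic_spaces V p W q \<Longrightarrow> isomorphic_spaces W q V p"
  unfolding isomorphic_spaces_def by blast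

lemma isomorphic_spaces_trans:
  assumes "isomorphic_spaces V p W q" "isomorphic_spaces W q X r"
  shows "isomorphic_spaces V p X r"
proof -
  from assms(1) obtain T U K L where 1: "bounded_op K V p W q T" "bounded_op L W q V p U"
    "\<And>f. f \<in> V \<Longrightarrow> U (T f) = f" "\<And>g. g \<in> W \<Longrightarrow> T (U g) = g"
    unfolding isomorphic_spaces_def by blast
  from assms(2) obtain T' U' K' L' where 2: "bounded_op K' W q X r T'" "bounded_op L' X r W q U'"
    "\<And>f. f \<in> W \<Longrightarrow> U' (T' f) = f" "\<And>g. g \<in> X \<Longrightarrow> T' (U' g) = g"
    unfolding isomorphic_spaces_def by blast
  have "U (U' (T' (T f))) = f" if "f \<in> V" for f
    using 1 2(3) bounded_opD(2)[OF 1(1)] that by simp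
  moreover have "T' (T (U (U' g))) = g" if "g \<in> X" for g
    using 2 1(4) bounded_opD(2)[OF 2(2)] that by simp
  ultimately show ?thesis unfolding isomorphic_spaces_def
    using bounded_op_comp[OF 2(1) 1(1)] bounded_op_comp[OF 1(2) 2(2)] by blast
qed

lemma isomorphic_spaces_imp_linearly_isomorphic:
  assumes "isomorphic_spaces V p W q"
  shows "linearly_isomorphic V p W q"
proof -
  from assms obtain T U K L where 1: "bounded_op K V p W q T" "bounded_op L W q V p U"
    "\<And>f. f \<in> V \<Longrightarrow> U (T f) = f" "\<And>g. g \<in> W \<Longrightarrow> T (U g) = g"
    unfolding isomorphic_spaces_def by blast
  have bij: "bij_betw T V W"
    by (rule bij_betw_byWitness[where f' = U]) (use 1 bounded_opD(2)[OF 1(1)] bounded_opD(2)[OF 1(2)] in auto)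
  have inv: "inv_into V T g = U g" if "g \<in> W" for g
    using 1 bounded_opD(2)[OF 1(2) that] bij that by (metis bij_betw_imp_inj_on inv_into_f_eq)
  have "\<forall>f\<in>V. \<forall>g\<in>V. T (\<lambda>x. f x + g x) = (\<lambda>y. T f y + T g y)"
    using bounded_opD(4)[OF 1(1)] by (simp add: plus_fun_def)
  moreover have "\<forall>c. \<forall>f\<in>V. T (\<lambda>x. c * f x) = (\<lambda>y. c * T f y)"
    using bounded_opD(5)[OF 1(1)] by simp
  moreover have "\<exists>C. \<forall>f\<in>V. q (T f) \<le> C * p f" using bounded_opD(3)[OF 1(1)] by blast
  moreover have "\<exists>C. \<forall>g\<in>W. p (inv_into V T g) \<le> C * q g"
    using bounded_opD(3)[OF 1(2)] inv by auto
  ultimately show ?thesis unfolding linearly_isomorphic_def using bij by blast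
qed

section \<open>Pelczynski decomposition\<close>

definition linf :: "('b \<Rightarrow> real) set \<Rightarrow> (('b \<Rightarrow> real) \<Rightarrow> real) \<Rightarrow> (nat \<times> 'b \<Rightarrow> real) set" where
  "linf X q = {F. (\<forall>i. (\<lambda>x. F (i, x)) \<in> X) \<and> bdd_above (range (\<lambda>i. q (\<lambda>x. F (i, x))))}"

definition linf_norm :: "(('b \<Rightarrow> real) \<Rightarrow> real) \<Rightarrow> (nat \<times> 'b \<Rightarrow> real) \<Rightarrow> real" where
  "linf_norm q F = (SUP i. q (\<lambda>x. F (i, x)))"

lemma linf_component:
  assumes "F \<in> linf X q"
  shows "(\<lambda>x. F (i, x)) \<in> X" "q (\<lambda>x. F (i, x)) \<le> linf_norm q F"
  using assms by (auto simp: linf_def linf_norm_def intro!: cSUP_upper)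

lemma linfI:
  assumes "\<And>i. (\<lambda>x. F (i, x)) \<in> X" "\<And>i. q (\<lambda>x. F (i, x)) \<le> C"
  shows "F \<in> linf X q" "linf_norm q F \<le> C"
  using assms by (auto simp: linf_def linf_norm_def intro!: bdd_aboveI cSUP_least)

lemma fun_space_linf:
  assumes X: "fun_space X q"
  shows "fun_space (linf X q) (linf_norm q)"
proof -
  have nonneg: "0 \<le> linf_norm q F" if "F \<in> linf X q" for F
    using linf_component[OF that, of 0] fun_spaceD(6)[OF X] by force
  have add: "F + G \<in> linf X q \<and> linf_norm q (F + G) \<le> linf_norm q F + linf_norm q G"
    if "F \<in> linf X q" "G \<in> linf X q" for F G
  proof -
    have eq: "(\<lambda>x. (F + G) (i, x)) = (\<lambda>x. F (i, x)) + (\<lambda>x. G (i, x))" for i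
      by (simp add: fun_eq_iff)
    have "q (\<lambda>x. (F + G) (i, x)) \<le> linf_norm q F + linf_norm q G" for i
      using fun_spaceD(3)[OF X linf_component(1)[OF that(1)] linf_component(1)[OF that(2)], of i i]
        linf_component(2)[OF that(1), of i] linf_component(2)[OF that(2), of i] unfolding eq by linarith
    moreover have "(\<lambda>x. (F + G) (i, x)) \<in> X" for i
      unfolding eq by (rule fun_spaceD(2)[OF X linf_component(1)[OF that(1)] linf_component(1)[OF that(2)]])
    ultimately show ?thesis using linfI by blast
  qed
  have scale: "(\<lambda>x. c * F x) \<in> linf X q \<and> linf_norm q (\<lambda>x. c * F x) \<le> \<bar>c\<bar> * linf_norm q F"
    if "F \<in> linf X q" for F c
  proof -
    have "(\<lambda>x. c * F (i, x)) \<in> X \<and> q (\<lambda>x. c * F (i, x)) \<le> \<bar>c\<bar> * linf_norm q F" for i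
      using linf_component[OF that, of i] fun_spaceD(4,5)[OF X, of "\<lambda>x. F (i, x)" c]
      by (simp add: mult_left_mono)
    then show ?thesis using linfI[of "\<lambda>x. c * F x"] by blast
  qed
  have "0 \<in> linf X q"
    using fun_spaceD(1)[OF X] by (intro linfI[where C = "q 0"]) (auto simp: zero_fun_def)
  then show ?thesis by (rule fun_spaceI) (use add scale nonneg in auto)
qed

text \<open>The pairing bijection turns a sequence into a sequence of sequences:
  \<open>slice\<close> and \<open>merge\<close> express that the l-infinity sum of countably many
  copies of \<open>linf X q\<close> is \<open>linf X q\<close> again.\<close>

definition slice :: "nat \<Rightarrow> (nat \<times> 'b \<Rightarrow> real) \<Rightarrow> nat \<times> 'b \<Rightarrow> real" where
  "slice i F = (\<lambda>(j, x). F (prod_encode (i, j), x))"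

definition merge :: "(nat \<Rightarrow> nat \<times> 'b \<Rightarrow> real) \<Rightarrow> nat \<times> 'b \<Rightarrow> real" where
  "merge G = (\<lambda>(k, x). case prod_decode k of (i, j) \<Rightarrow> G i (j, x))"

lemma slice_merge [simp]: "slice i (merge G) = G i"
  by (simp add: slice_def merge_def fun_eq_iff)

lemma merge_slice [simp]: "merge (\<lambda>i. slice i F) = F"
  by (auto simp: slice_def merge_def fun_eq_iff split_def)

lemma bounded_op_slice: "bounded_op 1 (linf X q) (linf_norm q) (linf X q) (linf_norm q) (slice i)"
proof -
  have "slice i F \<in> linf X q \<and> linf_norm q (slice i F) \<le> 1 * linf_norm q F"
    if "F \<in> linf X q" for F
    using linf_component[OF that] by (intro conjI linfI) (simp_all add: slice_def)
  then show ?thesis unfolding bounded_op_def by (auto simp: slice_def fun_eq_iff)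
qed

lemma bounded_op_merge:
  assumes T: "\<And>i. bounded_op K V p (linf X q) (linf_norm q) (T i)"
  shows "bounded_op K V p (linf X q) (linf_norm q) (\<lambda>v. merge (\<lambda>i. T i v))"
proof -
  have comp: "(\<lambda>x. merge (\<lambda>i. T i v) (k, x)) \<in> X \<and> q (\<lambda>x. merge (\<lambda>i. T i v) (k, x)) \<le> K * p v"
    if v: "v \<in> V" for v k
  proof -
    obtain i j where ij: "prod_decode k = (i, j)" by (cases "prod_decode k")
    have "(\<lambda>x. merge (\<lambda>i. T i v) (k, x)) = (\<lambda>x. T i v (j, x))"
      by (simp add: merge_def ij)
    then show ?thesis
      using linf_component[OF bounded_opD(2)[OF T[of i] v], of j] bounded_opD(3)[OF T[of i] v]
      by auto
  qed
  then have "merge (\<lambda>i. T i v) \<in> linf X q \<and> linf_norm q (merge (\<lambda>i. T i v)) \<le> K * p v"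
    if "v \<in> V" for v using linfI that by metis
  then show ?thesis using bounded_opD(1,4,5)[OF T]
    unfolding bounded_op_def by (auto simp: merge_def fun_eq_iff split: prod.split)
qed

text \<open>Pelczynski's decomposition method for a space of the form \<open>Z = \<ell>\<^sub>\<infinity>(X)\<close>, as an explicit
  isomorphism: writing \<open>P = A B\<close> and \<open>Q = T S\<close> for the two projections and identifying \<open>Z\<close> with
  the sequences \<open>(z\<^sub>i)\<close> in \<open>Z\<close>, first send \<open>z\<close> to the pair of \<open>y = B z\<^sub>0\<close> and
  \<open>w\<^sub>i = z\<^sub>i - P z\<^sub>i + P z\<^sub>i\<^sub>+\<^sub>1\<close>, then send \<open>(y, w)\<close> to \<open>y - Q y + T (S y, w\<^sub>0, w\<^sub>1, \<dots>)\<close>.\<close>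

lemma pelczynski_decomposition:
  fixes X :: "('b \<Rightarrow> real) set" and q V p
  defines "Z \<equiv> linf X q" and "n \<equiv> linf_norm q"
  assumes X: "fun_space X q" and V: "fun_space V p"
    and T: "bounded_op kT Z n V p T" and S: "bounded_op kS V p Z n S"
    and ST: "\<And>z. z \<in> Z \<Longrightarrow> S (T z) = z"
    and A: "bounded_op kA V p Z n A" and B: "bounded_op kB Z n V p B"
    and BA: "\<And>v. v \<in> V \<Longrightarrow> B (A v) = v"
  shows "isomorphic_spaces V p Z n"
proof -
  have Z: "fun_space Z n" unfolding Z_def n_def by (rule fun_space_linf[OF X])
  note sl = bounded_op_slice[of X q, folded Z_def n_def]
  note mg = bounded_op_merge[of _ V p X q, folded Z_def n_def] bounded_op_merge[of _ Z n X q, folded Z_def n_def]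
  define P where "P z = A (B z)" for z
  have P: "bounded_op (kA * kB) Z n Z n P"
    unfolding P_def by (rule bounded_op_comp[OF A B])
  have PZ: "P z \<in> Z" if "z \<in> Z" for z using bounded_opD(2)[OF P that] .
  have PP: "P (P z) = P z" if "z \<in> Z" for z
    unfolding P_def using BA bounded_opD(2)[OF B that] by simp
  define Q where "Q v = T (S v)" for v
  have Q: "bounded_op (kT * kS) V p V p Q"
    unfolding Q_def by (rule bounded_op_comp[OF T S])
  \<comment> \<open>Parts in the range of \<open>P\<close> move down one place while parts in its
    kernel stay. The range part of slice 0, lost in this way, is what \<open>y0\<close> keeps as an
    element of \<open>V\<close>.\<close>
  define w where "w z i = slice i z - P (slice i z) + P (slice (Suc i) z)" for z and i
  define y0 where "y0 z = B (slice 0 z)" for z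
  define G where "G z i = (case i of 0 \<Rightarrow> S (y0 z) | Suc j \<Rightarrow> w z j)" for z i
  \<comment> \<open>\<open>V\<close> is the sum of the kernel of \<open>Q\<close> and the image of
    \<open>T\<close>, a copy of \<open>Z\<close>. The kernel part of \<open>y0 z\<close> is left
    alone; its image part, with coordinate \<open>S (y0 z)\<close>, becomes slice 0 of the copy, and
    the \<open>w z j\<close> fill the other slices.\<close>
  define \<Phi> where "\<Phi> z = y0 z - Q (y0 z) + T (merge (G z))" for z
  define v0 where "v0 v = v - Q v + T (slice 0 (S v))" for v
  \<comment> \<open>\<open>v0 v\<close> is the recovered \<open>y0\<close>, and the slices from 1 on
    are the recovered \<open>w\<close>. Component \<open>i\<close> takes its kernel part from slice
    \<open>i + 1\<close> and its range part from slice \<open>i\<close>, or from \<open>v0 v\<close>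
    if \<open>i = 0\<close>.\<close>
  define H where "H v i = (case i of 0 \<Rightarrow> slice 1 (S v) - P (slice 1 (S v)) + A (v0 v)
      | Suc j \<Rightarrow> slice (Suc (Suc j)) (S v) - P (slice (Suc (Suc j)) (S v)) + P (slice (Suc j) (S v)))" for v i
  define \<Psi> where "\<Psi> v = merge (H v)" for v
  define k where "k = kA * kB"
  have w: "bounded_op (1 + k * 1 + k * 1) Z n Z n (\<lambda>z. w z i)" for i
    unfolding w_def k_def
    by (intro bounded_op_add bounded_op_minus Z sl bounded_op_comp[OF P])
  have y0: "bounded_op (kB * 1) Z n V p y0"
    unfolding y0_def by (intro bounded_op_comp[OF B] sl)
  define kG where "kG = max (kS * (kB * 1)) (1 + k * 1 + k * 1)"
  have G: "bounded_op kG Z n Z n (\<lambda>z. G z i)" for i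
  proof (cases i)
    case 0
    then show ?thesis unfolding G_def kG_def
      by (auto intro: bounded_op_mono[OF bounded_op_comp[OF S y0] _ Z])
  next
    case (Suc j)
    then show ?thesis unfolding G_def kG_def
      by (auto intro: bounded_op_mono[OF w _ Z])
  qed
  have mG: "bounded_op kG Z n Z n (\<lambda>z. merge (G z))" by (rule mg(2)[OF G])
  have \<Phi>: "\<exists>K. bounded_op K Z n V p \<Phi>"
    unfolding \<Phi>_def
    using bounded_op_add[OF V bounded_op_minus[OF V y0 bounded_op_comp[OF Q y0]] bounded_op_comp[OF T mG]]
    by blast
  have v0: "bounded_op (1 + kT * kS + kT * (1 * kS)) V p V p v0"
    unfolding v0_def
    by (intro bounded_op_add[OF V] bounded_op_minus[OF V] bounded_op_id Q bounded_op_comp[OF T]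
        bounded_op_comp[OF sl S])
  define k1 where "k1 = 1 * kS + k * (1 * kS)"
  have d1: "bounded_op k1 V p Z n (\<lambda>v. slice i (S v) - P (slice i (S v)))" for i
    unfolding k1_def k_def by (intro bounded_op_minus[OF Z] bounded_op_comp[OF P] bounded_op_comp[OF sl S])
  define kv where "kv = 1 + kT * kS + kT * (1 * kS)"
  define kH where "kH = max (k1 + kA * kv) (k1 + k * (1 * kS))"
  have H: "bounded_op kH V p Z n (\<lambda>v. H v i)" for i
  proof (cases i)
    case 0
    have "bounded_op (k1 + kA * kv) V p Z n (\<lambda>v. slice 1 (S v) - P (slice 1 (S v)) + A (v0 v))"
      unfolding kv_def by (intro bounded_op_add[OF Z] d1 bounded_op_comp[OF A v0])
    then show ?thesis using 0 unfolding H_def kH_def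
      by (auto intro: bounded_op_mono[OF _ _ V])
  next
    case (Suc j)
    have "bounded_op (k1 + k * (1 * kS)) V p Z n (\<lambda>v. slice (Suc (Suc j)) (S v)
        - P (slice (Suc (Suc j)) (S v)) + P (slice (Suc j) (S v)))"
      unfolding k_def by (intro bounded_op_add[OF Z] d1 bounded_op_comp[OF P] bounded_op_comp[OF sl S])
    then show ?thesis using Suc unfolding H_def kH_def
      by (auto intro: bounded_op_mono[OF _ _ V])
  qed
  have \<Psi>: "bounded_op kH V p Z n \<Psi>" unfolding \<Psi>_def by (rule mg(1)[OF H])
  have SV: "S v \<in> Z" if "v \<in> V" for v using bounded_opD(2)[OF S that] .
  have TZ: "T z \<in> V" if "z \<in> Z" for z using bounded_opD(2)[OF T that] .
  have slZ: "slice i z \<in> Z" if "z \<in> Z" for i z using bounded_opD(2)[OF sl that] .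
  have QV: "Q v \<in> V" if "v \<in> V" for v using bounded_opD(2)[OF Q that] .
  have SQ: "S (Q v) = S v" if "v \<in> V" for v unfolding Q_def by (rule ST[OF SV[OF that]])
  have left: "\<Psi> (\<Phi> z) = z" if z: "z \<in> Z" for z
  proof -
    have y: "y0 z \<in> V" using bounded_opD(2)[OF y0 z] .
    have m: "merge (G z) \<in> Z" using bounded_opD(2)[OF mG z] .
    have dV: "y0 z - Q (y0 z) \<in> V" by (intro fun_space_diff[OF V] y QV)
    have S\<Phi>: "S (\<Phi> z) = merge (G z)"
      unfolding \<Phi>_def bounded_opD(4)[OF S dV TZ[OF m]] bounded_op_diff[OF V S y QV[OF y]] SQ[OF y] ST[OF m]
      by simp
    have v0\<Phi>: "v0 (\<Phi> z) = y0 z"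
    proof -
      have "Q (\<Phi> z) = T (merge (G z))" unfolding Q_def S\<Phi> ..
      moreover have "slice 0 (S (\<Phi> z)) = S (y0 z)" unfolding S\<Phi> by (simp add: G_def)
      ultimately show ?thesis unfolding v0_def by (simp add: \<Phi>_def Q_def)
    qed
    have Pd: "P (w z i) = P (slice (Suc i) z)" for i
      unfolding w_def using slZ[OF z] fun_space_diff[OF Z] PZ PP
      by (simp add: bounded_opD(4)[OF P] bounded_op_diff[OF Z P])
    have "H (\<Phi> z) i = slice i z" for i
    proof (cases i)
      case 0
      then show ?thesis unfolding H_def v0\<Phi> S\<Phi> by (simp add: G_def Pd) (simp add: w_def y0_def P_def fun_eq_iff)
    next
      case (Suc j)
      then show ?thesis unfolding H_def S\<Phi> by (simp add: G_def Pd) (simp add: w_def fun_eq_iff)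
    qed
    then have "H (\<Phi> z) = (\<lambda>i. slice i z)" by blast
    then show ?thesis unfolding \<Psi>_def by simp
  qed
  have right: "\<Phi> (\<Psi> v) = v" if v: "v \<in> V" for v
  proof -
    have vv: "v0 v \<in> V" using bounded_opD(2)[OF v0 v] .
    note sS = slZ[OF SV[OF v]]
    have d: "slice i (S v) - P (slice i (S v)) \<in> Z" for i by (intro fun_space_diff[OF Z] sS PZ)
    have Bd: "B (slice i (S v) - P (slice i (S v))) = 0" for i
      using sS by (simp add: bounded_op_diff[OF Z B _ PZ]) (simp add: P_def BA bounded_opD(2)[OF B])
    have Pd: "P (slice i (S v) - P (slice i (S v))) = 0" for i
      using sS by (simp add: bounded_op_diff[OF Z P _ PZ] PP)
    have AZ: "A (v0 v) \<in> Z" using bounded_opD(2)[OF A vv] .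
    have y0\<Psi>: "y0 (\<Psi> v) = v0 v"
      unfolding y0_def \<Psi>_def slice_merge
      by (simp add: H_def bounded_opD(4)[OF B d AZ] Bd BA[OF vv] del: One_nat_def)
    have PH: "P (H v 0) = A (v0 v)" "P (H v (Suc j)) = P (slice (Suc j) (S v))" for j
      by (simp_all add: H_def bounded_opD(4)[OF P d AZ] bounded_opD(4)[OF P d PZ[OF sS]] Pd PP[OF sS] del: One_nat_def)
         (simp add: P_def BA[OF vv])
    have w\<Psi>: "w (\<Psi> v) i = slice (Suc i) (S v)" for i
      unfolding w_def \<Psi>_def slice_merge
      by (cases i) (simp_all add: PH, simp_all add: H_def)
    have Sv0: "S (v0 v) = slice 0 (S v)"
      unfolding v0_def bounded_opD(4)[OF S fun_space_diff(1)[OF V v QV[OF v]] TZ[OF sS]]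
        bounded_op_diff[OF V S v QV[OF v]] SQ[OF v] ST[OF sS] by simp
    have "G (\<Psi> v) = (\<lambda>i. slice i (S v))"
      unfolding G_def y0\<Psi> w\<Psi> Sv0 by (auto simp: fun_eq_iff split: nat.split)
    then have "\<Phi> (\<Psi> v) = v0 v - T (S (v0 v)) + T (S v)"
      unfolding \<Phi>_def y0\<Psi> Q_def by simp
    also have "\<dots> = v" unfolding Sv0 by (simp add: v0_def Q_def)
    finally show ?thesis .
  qed
  show ?thesis unfolding isomorphic_spaces_def using \<Phi> \<Psi> left right by blast
qed

section \<open>Generalized limits\<close>

text \<open>A Banach limit without shift invariance. The last clause makes it ignore finitely many
  terms and extend the ordinary limit; only its behaviour on bounded sequences is specified.\<close>

definition glim :: "(nat \<Rightarrow> real) \<Rightarrow> real" where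
  "glim = (SOME L. (\<forall>a b. Bseq a \<longrightarrow> Bseq b \<longrightarrow> L (\<lambda>n. a n + b n) = L a + L b) \<and>
     (\<forall>c a. Bseq a \<longrightarrow> L (\<lambda>n. c * a n) = c * L a) \<and>
     (\<forall>c a. Bseq a \<longrightarrow> (\<forall>\<^sub>F n in sequentially. a n \<le> c) \<longrightarrow> L a \<le> c))"

lemma Bseq_add_seq:
  fixes a b :: "nat \<Rightarrow> 'a::real_normed_vector"
  assumes "Bseq a" "Bseq b"
  shows "Bseq (\<lambda>n. a n + b n)"
proof -
  obtain K L where "\<And>n. norm (a n) \<le> K" "\<And>n. norm (b n) \<le> L" using assms by (auto simp: Bseq_def)
  then have "norm (a n + b n) \<le> K + L" for n by (meson norm_add_rule_thm)
  then show ?thesis by (rule BseqI')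
qed

text \<open>The evaluations \<open>a \<mapsto> a n\<close> at \<open>n = 0, 1, \<dots>\<close> form a sequence in a product of compact intervals,
  and every cluster point of that sequence is a generalized limit.\<close>

lemma glim_exists:
  "\<exists>L :: (nat \<Rightarrow> real) \<Rightarrow> real. (\<forall>a b. Bseq a \<longrightarrow> Bseq b \<longrightarrow> L (\<lambda>n. a n + b n) = L a + L b) \<and>
     (\<forall>c a. Bseq a \<longrightarrow> L (\<lambda>n. c * a n) = c * L a) \<and>
     (\<forall>c a. Bseq a \<longrightarrow> (\<forall>\<^sub>F n in sequentially. a n \<le> c) \<longrightarrow> L a \<le> c)"
proof -
  \<comment> \<open>Unbounded sequences get the value 0, so that every coordinate of
    \<open>e n\<close> stays in an interval independent of \<open>n\<close>.\<close>
  define e :: "nat \<Rightarrow> (nat \<Rightarrow> real) \<Rightarrow> real" where "e n a = (if Bseq a then a n else 0)" for n a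
  have "\<exists>B. \<forall>n. \<bar>e n a\<bar> \<le> B" for a
  proof (cases "Bseq a")
    case True
    then show ?thesis using BseqD[OF True] by (auto simp: e_def)
  next
    case False
    then show ?thesis by (intro exI[of _ 0]) (simp add: e_def)
  qed
  then obtain B where B: "\<bar>e n a\<bar> \<le> B a" for n a by metis
  define K where "K = (\<Pi>\<^sub>E a\<in>UNIV. {- B a..B a})"
  have "compactin (product_topology (\<lambda>_. euclidean) UNIV) K"
    unfolding K_def by (simp add: compactin_PiE)
  then have "compact K" by (simp add: euclidean_product_topology)
  moreover have "\<forall>\<^sub>F x in filtermap e sequentially. x \<in> K"
    using B by (auto simp: K_def eventually_filtermap abs_le_iff intro!: always_eventually)
      (metis minus_le_iff)
  ultimately obtain L where L: "inf (nhds L) (filtermap e sequentially) \<noteq> bot"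
    unfolding compact_filter by (metis filtermap_bot_iff sequentially_bot)
  \<comment> \<open>Each law of a limit is a closed condition that the evaluations satisfy
    eventually, so it passes to the cluster point.\<close>
  have closedI: "L \<in> C" if "closed C" "\<forall>\<^sub>F n in sequentially. e n \<in> C" for C
  proof (rule ccontr)
    assume "L \<notin> C"
    then have "\<forall>\<^sub>F x in nhds L. x \<notin> C"
      using \<open>closed C\<close> eventually_nhds[of "\<lambda>x. x \<notin> C" L] by (metis ComplD ComplI open_Compl)
    moreover have "\<forall>\<^sub>F x in filtermap e sequentially. x \<in> C"
      using that(2) by (simp add: eventually_filtermap)
    ultimately have "\<forall>\<^sub>F x in inf (nhds L) (filtermap e sequentially). False"
      unfolding eventually_inf by blast
    then show False using L by (simp add: eventually_False)
  qed
  show ?thesis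
  proof (intro exI[of _ L] conjI allI impI)
    fix a b :: "nat \<Rightarrow> real" assume ab: "Bseq a" "Bseq b"
    then have "Bseq (\<lambda>n. a n + b n)" by (rule Bseq_add_seq)
    then have "L \<in> {h. h (\<lambda>n. a n + b n) = h a + h b}"
      using ab by (intro closedI closed_Collect_eq continuous_intros)
        (auto simp: e_def intro!: continuous_intros)
    then show "L (\<lambda>n. a n + b n) = L a + L b" by simp
  next
    fix c and a :: "nat \<Rightarrow> real" assume a: "Bseq a"
    then have "Bseq (\<lambda>n. c * a n)"
      using Bseq_mult[of "\<lambda>_. c" a] by auto
    then have "L \<in> {h. h (\<lambda>n. c * a n) = c * h a}"
      using a by (intro closedI closed_Collect_eq continuous_intros)
        (auto simp: e_def intro!: continuous_intros)
    then show "L (\<lambda>n. c * a n) = c * L a" by simp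
  next
    fix c and a :: "nat \<Rightarrow> real" assume a: "Bseq a" "\<forall>\<^sub>F n in sequentially. a n \<le> c"
    then have "L \<in> {h. h a \<le> c}"
      by (intro closedI closed_Collect_le continuous_intros)
        (auto simp: e_def intro!: continuous_intros)
    then show "L a \<le> c" by simp
  qed
qed

lemma
  assumes a: "Bseq a"
  shows glim_add: "Bseq b \<Longrightarrow> glim (\<lambda>n. a n + b n) = glim a + glim b"
    and glim_cmult: "glim (\<lambda>n. c * a n) = c * glim a"
    and glim_le: "(\<forall>\<^sub>F n in sequentially. a n \<le> c) \<Longrightarrow> glim a \<le> c"
  using someI_ex[OF glim_exists, folded glim_def] a by blast+

text \<open>Estimates up to a vanishing error become exact in the generalized limit; the Lipschitz
  bounds for blow-ups are of this kind.\<close>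

lemma glim_diff_le:
  assumes a: "Bseq a" and b: "Bseq b" and e: "e \<longlonglongrightarrow> 0"
    and le: "\<forall>\<^sub>F n in sequentially. a n - b n \<le> c + e n"
  shows "glim a - glim b \<le> c"
proof (rule field_le_epsilon)
  fix t :: real assume "0 < t"
  have nb: "Bseq (\<lambda>n. - 1 * b n)" using b by (simp add: Bseq_minus_iff)
  have "\<forall>\<^sub>F n in sequentially. e n < t" using e \<open>0 < t\<close> by (rule order_tendstoD(2))
  with le have "\<forall>\<^sub>F n in sequentially. a n + - 1 * b n \<le> c + t"
    by eventually_elim simp
  from glim_le[OF Bseq_add_seq[OF a nb] this]
  show "glim a - glim b \<le> c + t" unfolding glim_add[OF a nb] glim_cmult[OF b] by simp
qed

lemma glim_abs_diff_le:
  assumes a: "Bseq a" and b: "Bseq b" and e: "e \<longlonglongrightarrow> 0"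
    and le: "\<forall>\<^sub>F n in sequentially. \<bar>a n - b n\<bar> \<le> c + e n"
  shows "\<bar>glim a - glim b\<bar> \<le> c"
proof -
  have "glim a - glim b \<le> c"
    by (rule glim_diff_le[OF a b e]) (use le in eventually_elim, auto)
  moreover have "glim b - glim a \<le> c"
    by (rule glim_diff_le[OF b a e]) (use le in eventually_elim, auto)
  ultimately show ?thesis by simp
qed

lemma glim_eq_limit:
  assumes "a \<longlonglongrightarrow> l"
  shows "glim a = l"
proof -
  have a: "Bseq a" using assms by (intro convergent_imp_Bseq convergentI)
  have "(\<lambda>n. \<bar>a n - l\<bar>) \<longlonglongrightarrow> 0"
    using assms by (simp add: LIM_zero tendsto_rabs_zero)
  have const: "glim (\<lambda>n. l) = l"
  proof -
    have "glim (\<lambda>n. l) \<le> l" "glim (\<lambda>n. - l) \<le> - l" by (rule glim_le; simp)+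
    then show ?thesis using glim_cmult[of "\<lambda>n. l" "-1"] by simp
  qed
  have "\<bar>glim a - glim (\<lambda>n. l)\<bar> \<le> 0"
    by (rule glim_abs_diff_le[OF a _ \<open>(\<lambda>n. \<bar>a n - l\<bar>) \<longlonglongrightarrow> 0\<close>]) simp_all
  then show ?thesis by (simp add: const)
qed

section \<open>Linear extension of Lipschitz functions\<close>

text \<open>Scaled to the unit ball, which finitely many balls of radius \<open>c / 2\<close> cover,
  the points choose distinct covering balls. Hence one \<open>N\<close> serves all places and
  scales.\<close>

lemma packing_bound:
  fixes c :: real
  assumes "0 < c"
  shows "\<exists>N. \<forall>(x :: 'a::euclidean_space) r S. 0 < r \<longrightarrow> S \<subseteq> cball x r \<longrightarrow>
    (\<forall>p\<in>S. \<forall>q\<in>S. p \<noteq> q \<longrightarrow> c * r \<le> dist p q) \<longrightarrow> finite S \<and> card S \<le> N"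
proof -
  have "compact (cball (0::'a) 1)" by simp
  moreover have "cball (0::'a) 1 \<subseteq> (\<Union>t\<in>cball 0 1. ball t (c / 2))"
    by (rule subsetI, rule UN_I) (use \<open>0 < c\<close> in auto)
  ultimately obtain T where T: "finite T" "cball (0::'a) 1 \<subseteq> (\<Union>t\<in>T. ball t (c / 2))"
    using compactE_image[of "cball (0::'a) 1" "cball 0 1" "\<lambda>t. ball t (c / 2)"] by (metis open_ball)
  have "finite S \<and> card S \<le> card T"
    if r: "0 < r" and S: "S \<subseteq> cball x r" and sep: "\<forall>p\<in>S. \<forall>q\<in>S. p \<noteq> q \<longrightarrow> c * r \<le> dist p q"
    for x :: 'a and r S
  proof -
    have "\<exists>t\<in>T. dist t ((1 / r) *\<^sub>R (p - x)) < c / 2" if "p \<in> S" for p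
    proof -
      have "norm (p - x) \<le> r" using S that by (auto simp: dist_norm norm_minus_commute)
      then have "(1 / r) *\<^sub>R (p - x) \<in> cball 0 1" using r by simp
      then have "(1 / r) *\<^sub>R (p - x) \<in> (\<Union>t\<in>T. ball t (c / 2))" using T(2) by blast
      then show ?thesis by simp
    qed
    then obtain t where t: "\<And>p. p \<in> S \<Longrightarrow> t p \<in> T"
        "\<And>p. p \<in> S \<Longrightarrow> dist (t p) ((1 / r) *\<^sub>R (p - x)) < c / 2" by metis
    have "inj_on t S"
    proof (rule inj_onI, rule ccontr)
      fix p q assume pq: "p \<in> S" "q \<in> S" "t p = t q" "p \<noteq> q"
      have "dist ((1 / r) *\<^sub>R (p - x)) ((1 / r) *\<^sub>R (q - x)) < c"
        using t(2)[OF pq(1)] t(2)[OF pq(2)] pq(3) by (metis dist_commute dist_triangle_half_l)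
      moreover have "dist ((1 / r) *\<^sub>R (p - x)) ((1 / r) *\<^sub>R (q - x)) = dist p q / r"
        using r by (simp add: dist_norm flip: scaleR_diff_right)
      ultimately have "dist p q / r < c" by simp
      then have "dist p q < c * r" using r by (simp add: pos_divide_less_eq)
      then show False using sep pq by force
    qed
    moreover have "t ` S \<subseteq> T" using t(1) by blast
    ultimately show ?thesis using T(1) by (meson card_inj_on_le finite_imageD finite_subset)
  qed
  then show ?thesis by blast
qed

text \<open>Zorn's lemma; maximality gives the covering, since a point far from all of
  \<open>P\<close> could be added. The separation depends on the pair of points so that the net can
  be finer near a set than away from it.\<close>

lemma maximal_separated_set:
  fixes \<rho> :: "'a::metric_space \<Rightarrow> 'a \<Rightarrow> real"
  assumes sym: "\<And>x y. \<rho> x y = \<rho> y x" and pos: "\<And>x y. 0 < \<rho> x y"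
  shows "\<exists>P. (\<forall>p\<in>P. \<forall>q\<in>P. p \<noteq> q \<longrightarrow> \<rho> p q \<le> dist p q) \<and> (\<forall>x. \<exists>p\<in>P. dist x p < \<rho> x p)"
proof -
  let ?sep = "\<lambda>P. \<forall>p\<in>P. \<forall>q\<in>P. p \<noteq> q \<longrightarrow> \<rho> p q \<le> dist p q"
  have "\<exists>P\<in>Collect ?sep. \<forall>Q\<in>Collect ?sep. P \<subseteq> Q \<longrightarrow> Q = P"
  proof (rule subset_Zorn')
    fix \<C> assume C: "subset.chain (Collect ?sep) \<C>"
    have "\<rho> p q \<le> dist p q" if pq: "P \<in> \<C>" "p \<in> P" "Q \<in> \<C>" "q \<in> Q" "p \<noteq> q" for P Q p q
    proof -
      have "P \<subseteq> Q \<or> Q \<subseteq> P" using C pq unfolding subset_chain_def by meson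
      then show ?thesis using C pq unfolding subset_chain_def by blast
    qed
    then show "\<Union>\<C> \<in> Collect ?sep" by blast
  qed
  then obtain P where "P \<in> Collect ?sep" and maxc: "\<forall>Q\<in>Collect ?sep. P \<subseteq> Q \<longrightarrow> Q = P" by (elim bexE)
  then have P: "?sep P" by simp
  have max: "Q = P" if "?sep Q" "P \<subseteq> Q" for Q
    using bspec[OF maxc, of Q] that by simp
  have "\<exists>p\<in>P. dist x p < \<rho> x p" for x
  proof (rule ccontr)
    assume far: "\<not> ?thesis"
    then have "x \<notin> P" using pos[of x x] by force
    moreover have "?sep (insert x P)"
      using P far sym by (auto simp: not_less dist_commute)
    ultimately show False using max[of "insert x P"] by blast
  qed
  then show ?thesis using P by blast
qed

text \<open>\<open>d\<close> is the local mesh, positive even on \<open>M\<close>, and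
  \<open>\<pi>\<close> picks the point of \<open>M\<close> at which functions are sampled. The
  packing constant \<open>1 / 48\<close> is fitted to \<open>near x\<close>: its points lie within
  \<open>2 * d x\<close> of \<open>x\<close> and have \<open>d p\<close> at least
  \<open>d x / 3\<close>, so they are at least \<open>d x / 24\<close> apart.\<close>

locale whitney_net =
  fixes M P :: "'a::euclidean_space set" and d :: "'a \<Rightarrow> real" and \<pi> :: "'a \<Rightarrow> 'a" and N :: nat
  assumes d_pos: "0 < d x" and d_triangle: "d x \<le> d y + dist x y"
    and proj: "\<pi> x \<in> M" "dist x (\<pi> x) \<le> 2 * d x"
    and separated: "p \<in> P \<Longrightarrow> q \<in> P \<Longrightarrow> p \<noteq> q \<Longrightarrow> max (d p) (d q) / 8 \<le> dist p q"
    and cover: "\<exists>p\<in>P. dist x p < max (d x) (d p) / 8"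
    and packing: "0 < r \<Longrightarrow> S \<subseteq> cball x r \<Longrightarrow> \<forall>p\<in>S. \<forall>q\<in>S. p \<noteq> q \<longrightarrow> 1 / 48 * r \<le> dist p q
      \<Longrightarrow> finite S \<and> card S \<le> N"
begin

text \<open>The set \<open>near x\<close> contains every point of the net that has nonzero weight somewhere in
  the ball of radius \<open>d x / 2\<close> about \<open>x\<close>.\<close>

definition near :: "'a \<Rightarrow> 'a set" where
  "near x = {p \<in> P. dist x p \<le> 2 * d x \<and> d x \<le> 3 * d p}"

definition wt :: "'a \<Rightarrow> 'a \<Rightarrow> real" where
  "wt x p = max 0 (d p - 2 * dist x p)"

definition ext :: "('a \<Rightarrow> real) \<Rightarrow> 'a \<Rightarrow> real" where
  "ext f x = (\<Sum>p\<in>near x. wt x p * f (\<pi> p)) / (\<Sum>p\<in>near x. wt x p)"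

lemma near_finite: "finite (near x)" and near_card: "card (near x) \<le> N"
proof -
  have "1 / 48 * (2 * d x) \<le> dist p q" if "p \<in> near x" "q \<in> near x" "p \<noteq> q" for p q
    using separated[of p q] that by (auto simp: near_def)
  then have "finite (near x) \<and> card (near x) \<le> N"
    using d_pos[of x] by (intro packing[of "2 * d x" _ x]) (auto simp: near_def)
  then show "finite (near x)" "card (near x) \<le> N" by auto
qed

lemma wt_nonneg [simp]: "0 \<le> wt x p"
  by (simp add: wt_def)

lemma wt_lipschitz: "\<bar>wt x p - wt y p\<bar> \<le> 2 * dist x y"
  using dist_triangle[of x p y] dist_triangle[of y p x] by (auto simp: wt_def dist_commute)

text \<open>Nonzero weight at \<open>y\<close> means that \<open>dist y p\<close> is below
  \<open>d p / 2\<close>, hence \<open>d p < 2 * d y\<close> and \<open>d y < 3 / 2 * d p\<close>;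
  closeness of \<open>x\<close> and \<open>y\<close> gives \<open>d y \<le> 3 / 2 * d x\<close> and
  \<open>d x \<le> 2 * d y\<close>. Chaining these yields the constants 2 and 3 of
  \<open>near\<close>.\<close>

lemma near_if_wt_nonzero:
  assumes "p \<in> P" "dist x y \<le> d x / 2" "wt y p \<noteq> 0"
  shows "p \<in> near x"
proof -
  have "2 * dist y p < d p" using assms(3) by (auto simp: wt_def max_def split: if_splits)
  then show ?thesis
    using assms(1,2) d_triangle[of p y] d_triangle[of y p] d_triangle[of x y] d_triangle[of y x]
      dist_triangle[of x p y] by (auto simp: near_def dist_commute)
qed

text \<open>Both index sets contain every net point of nonzero weight at \<open>y\<close>. Averages
  at \<open>x\<close> and at a nearby \<open>y\<close> can thus be compared over the one set
  \<open>near x\<close>.\<close>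

lemma sum_near:
  assumes "dist x y \<le> d x / 2"
  shows "(\<Sum>p\<in>near x. wt y p * g p) = (\<Sum>p\<in>near y. wt y p * g p)"
proof (rule sum.mono_neutral_cong)
  fix p assume "p \<in> near y - near x"
  then show "wt y p * g p = 0" using near_if_wt_nonzero[OF _ assms] by (auto simp: near_def)
next
  fix p assume "p \<in> near x - near y"
  then show "wt y p * g p = 0"
    using near_if_wt_nonzero[of p y y] d_pos[of y] by (auto simp: near_def)
qed (auto simp: near_finite)

text \<open>The net point supplied by \<open>cover\<close> already has weight at least
  \<open>d x / 2\<close>, so the denominator of \<open>ext\<close> is never small relative to the
  mesh.\<close>

lemma sum_wt_ge: "d x \<le> 2 * (\<Sum>p\<in>near x. wt x p)"
proof -
  obtain p where p: "p \<in> P" "dist x p < max (d x) (d p) / 8" using cover by blast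
  have w: "d x / 2 \<le> wt x p"
    using p(2) d_triangle[of x p] d_triangle[of p x] by (auto simp: wt_def dist_commute)
  then have "p \<in> near x" using near_if_wt_nonzero[of p x x] p d_pos[of x] by auto
  then have "wt x p \<le> (\<Sum>p\<in>near x. wt x p)"
    by (intro member_le_sum near_finite) auto
  then show ?thesis using w by simp
qed

lemma sum_wt_pos: "0 < (\<Sum>p\<in>near x. wt x p)"
  using sum_wt_ge[of x] d_pos[of x] by linarith

lemma ext_diff_const: "ext f x - c = (\<Sum>p\<in>near x. wt x p * (f (\<pi> p) - c)) / (\<Sum>p\<in>near x. wt x p)"
  using sum_wt_pos[of x]
  by (simp add: ext_def field_simps sum_subtractf flip: sum_distrib_left)

lemma near_value:
  assumes f: "L-lipschitz_on M f" and p: "p \<in> near x" and m: "m \<in> M"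
  shows "\<bar>f (\<pi> p) - f m\<bar> \<le> L * (8 * d x + dist x m)"
proof -
  have "dist (\<pi> p) m \<le> dist p (\<pi> p) + dist x p + dist x m"
    using dist_triangle[of "\<pi> p" m p] dist_triangle[of p m x] by (simp add: dist_commute)
  also have "\<dots> \<le> 8 * d x + dist x m"
    using p proj(2)[of p] d_triangle[of p x] by (auto simp: near_def dist_commute)
  finally have "L * dist (\<pi> p) m \<le> L * (8 * d x + dist x m)"
    using lipschitz_on_nonneg[OF f] by (rule mult_left_mono)
  then show ?thesis
    using lipschitz_onD[OF f proj(1)[of p] m] by (simp add: dist_real_def)
qed

lemma average_bound:
  assumes "\<And>p. p \<in> near x \<Longrightarrow> \<bar>h p\<bar> \<le> K"
  shows "\<bar>\<Sum>p\<in>near x. wt x p * h p\<bar> \<le> K * (\<Sum>p\<in>near x. wt x p)"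
proof -
  have "\<bar>\<Sum>p\<in>near x. wt x p * h p\<bar> \<le> (\<Sum>p\<in>near x. \<bar>wt x p * h p\<bar>)" by (rule sum_abs)
  also have "\<dots> \<le> (\<Sum>p\<in>near x. K * wt x p)"
    using assms by (intro sum_mono) (simp add: abs_mult mult.commute mult_right_mono)
  finally show ?thesis by (simp add: sum_distrib_left)
qed

lemma ext_approx:
  assumes f: "L-lipschitz_on M f" and m: "m \<in> M"
  shows "\<bar>ext f x - f m\<bar> \<le> L * (8 * d x + dist x m)"
  using average_bound[of x "\<lambda>p. f (\<pi> p) - f m", OF near_value[OF f _ m]] sum_wt_pos[of x]
  unfolding ext_diff_const by (simp add: field_simps)

text \<open>Relative to the constant \<open>c\<close> the averaged values are at most
  \<open>H\<close>, which is proportional to \<open>d x\<close>. At most \<open>N\<close> weights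
  move, each by at most \<open>2 * dist x y\<close>, and the total weight is at least
  \<open>d x / 2\<close>, so \<open>d x\<close> cancels. Numerator and denominator each contribute
  an error \<open>D * H / W x\<close>; together they give the factor 80.\<close>

lemma ext_lipschitz_near:
  assumes f: "L-lipschitz_on M f" and xy: "dist x y \<le> d x / 2"
  shows "\<bar>ext f x - ext f y\<bar> \<le> 80 * real N * L * dist x y"
proof -
  define c where "c = f (\<pi> x)"
  define h where "h p = f (\<pi> p) - c" for p
  define H where "H = 10 * L * d x"
  define D where "D = real N * (2 * dist x y)"
  define S where "S z = (\<Sum>p\<in>near x. wt z p * h p)" for z
  define W where "W z = (\<Sum>p\<in>near x. wt z p)" for z
  have L: "0 \<le> L" using lipschitz_on_nonneg[OF f] .
  have H0: "0 \<le> H" unfolding H_def using L d_pos[of x] by simp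
  have h: "\<bar>h p\<bar> \<le> H" if "p \<in> near x" for p
  proof -
    have "\<bar>h p\<bar> \<le> L * (8 * d x + dist x (\<pi> x))"
      unfolding h_def c_def by (rule near_value[OF f that proj(1)])
    also have "\<dots> \<le> L * (10 * d x)" using L proj(2)[of x] by (intro mult_left_mono) auto
    finally show ?thesis by (simp add: H_def)
  qed
  have Wy: "W y = (\<Sum>p\<in>near y. wt y p)" using sum_near[OF xy, of "\<lambda>_. 1"] by (simp add: W_def)
  have Sy: "S y = (\<Sum>p\<in>near y. wt y p * h p)" using sum_near[OF xy] by (simp add: S_def)
  have W: "0 < W x" "0 < W y" "d x \<le> 2 * W x"
    using sum_wt_pos[of x] sum_wt_pos[of y] sum_wt_ge[of x] Wy by (simp_all add: W_def)
  have "\<bar>S y\<bar> \<le> (\<Sum>p\<in>near x. \<bar>wt y p * h p\<bar>)" unfolding S_def by (rule sum_abs)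
  also have "\<dots> \<le> (\<Sum>p\<in>near x. H * wt y p)"
    using h by (intro sum_mono) (simp add: abs_mult mult.commute mult_right_mono)
  finally have S_le: "\<bar>S y\<bar> \<le> H * W y" by (simp add: W_def sum_distrib_left)
  have card: "real (card (near x)) * t \<le> real N * t" if "0 \<le> t" for t
    using near_card[of x] that by (intro mult_right_mono) auto
  have "\<bar>W x - W y\<bar> \<le> (\<Sum>p\<in>near x. \<bar>wt x p - wt y p\<bar>)"
    unfolding W_def sum_subtractf[symmetric] by (rule sum_abs)
  also have "\<dots> \<le> (\<Sum>p\<in>near x. 2 * dist x y)" by (intro sum_mono wt_lipschitz)
  also have "\<dots> \<le> D" unfolding D_def using card[of "2 * dist x y"] by simp
  finally have dW: "\<bar>W x - W y\<bar> \<le> D" .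
  have "\<bar>S x - S y\<bar> \<le> (\<Sum>p\<in>near x. \<bar>wt x p * h p - wt y p * h p\<bar>)"
    unfolding S_def sum_subtractf[symmetric] by (rule sum_abs)
  also have "\<dots> \<le> (\<Sum>p\<in>near x. 2 * dist x y * H)"
  proof (rule sum_mono)
    fix p assume p: "p \<in> near x"
    have "\<bar>wt x p * h p - wt y p * h p\<bar> = \<bar>wt x p - wt y p\<bar> * \<bar>h p\<bar>"
      by (simp add: abs_mult flip: left_diff_distrib)
    also have "\<dots> \<le> 2 * dist x y * H" by (intro mult_mono wt_lipschitz h p) auto
    finally show "\<bar>wt x p * h p - wt y p * h p\<bar> \<le> 2 * dist x y * H" .
  qed
  also have "\<dots> \<le> D * H"
    unfolding D_def using card[of "2 * dist x y * H"] H0 by (simp add: mult.assoc)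
  finally have dS: "\<bar>S x - S y\<bar> \<le> D * H" .
  have "ext f x - ext f y = S x / W x - S y / W y"
    using ext_diff_const[of f x c] ext_diff_const[of f y c] Wy Sy by (simp add: S_def W_def h_def)
  also have "\<dots> = ((S x - S y) + S y / W y * (W y - W x)) / W x"
    using W by (simp add: field_simps)
  finally have "\<bar>ext f x - ext f y\<bar> = \<bar>(S x - S y) + S y / W y * (W y - W x)\<bar> / W x"
    using W by (simp add: abs_divide)
  also have "\<dots> \<le> (D * H + H * D) / W x"
  proof (intro divide_right_mono order_trans[OF abs_triangle_ineq] add_mono dS)
    have "\<bar>S y / W y\<bar> \<le> H" using S_le W by (simp add: abs_divide field_simps)
    then show "\<bar>S y / W y * (W y - W x)\<bar> \<le> H * D"
      unfolding abs_mult using dW H0 by (intro mult_mono) auto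
  qed (use W in simp)
  also have "\<dots> = 40 * real N * L * dist x y * (d x / W x)"
    by (simp add: D_def H_def)
  also have "\<dots> \<le> 40 * real N * L * dist x y * 2"
    using W L by (intro mult_left_mono) (auto simp: field_simps)
  finally show ?thesis by simp
qed

lemma ext_lipschitz:
  assumes f: "L-lipschitz_on M f"
  shows "((80 * real N + 49) * L)-lipschitz_on UNIV (ext f)"
proof (rule lipschitz_onI)
  have L: "0 \<le> L" using lipschitz_on_nonneg[OF f] .
  then show "0 \<le> (80 * real N + 49) * L" by simp
  fix x y :: 'a
  have close: "\<bar>ext f x - ext f y\<bar> \<le> (80 * real N + 49) * L * dist x y" if "dist x y \<le> d x / 2" for x y
  proof -
    have "0 \<le> 49 * (L * dist x y)" using L by simp
    then show ?thesis using ext_lipschitz_near[OF f that] by (simp add: algebra_simps)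
  qed
  have "\<bar>ext f x - ext f y\<bar> \<le> (80 * real N + 49) * L * dist x y"
  proof (cases "dist x y \<le> d x / 2 \<or> dist x y \<le> d y / 2")
    case True
    then show ?thesis using close[of x y] close[of y x] by (auto simp: dist_commute abs_minus_commute)
  next
    case False
    \<comment> \<open>Both meshes are now below \<open>2 * dist x y\<close>, so a detour through the
      sample points is affordable: \<open>12 * 2 + 1 + 12 * 2 = 49\<close>.\<close>
    have a: "\<bar>ext f z - f (\<pi> z)\<bar> \<le> L * (10 * d z)" for z
      using ext_approx[OF f proj(1), of z z] mult_left_mono[OF proj(2)[of z] L]
      by (simp add: algebra_simps)
    have "dist (\<pi> x) (\<pi> y) \<le> dist x (\<pi> x) + dist x y + dist y (\<pi> y)"
      using dist_triangle[of "\<pi> x" "\<pi> y" x] dist_triangle[of x "\<pi> y" y] by (simp add: dist_commute)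
    also have "\<dots> \<le> 2 * d x + dist x y + 2 * d y" using proj(2)[of x] proj(2)[of y] by simp
    finally have "\<bar>f (\<pi> x) - f (\<pi> y)\<bar> \<le> L * (2 * d x + dist x y + 2 * d y)"
      using lipschitz_onD[OF f proj(1)[of x] proj(1)[of y]] L
      by (simp add: dist_real_def) (meson mult_left_mono order_trans)
    then have "\<bar>ext f x - ext f y\<bar> \<le> L * (10 * d x) + L * (2 * d x + dist x y + 2 * d y) + L * (10 * d y)"
      using a[of x] a[of y] by linarith
    also have "\<dots> = L * (12 * d x + dist x y + 12 * d y)" by (simp add: algebra_simps)
    also have "\<dots> \<le> L * (49 * dist x y)" using False L by (intro mult_left_mono) auto
    also have "\<dots> \<le> (80 * real N + 49) * L * dist x y" using L by (simp add: algebra_simps)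
    finally show ?thesis .
  qed
  then show "dist (ext f x) (ext f y) \<le> (80 * real N + 49) * L * dist x y"
    by (simp add: dist_real_def)
qed

end

text \<open>With the mesh \<open>max \<epsilon> (infdist x M)\<close> the averages make sense on
  \<open>M\<close> as well, at the price of an error proportional to \<epsilon> there. What matters
  is that \<open>C\<close> does not depend on \<epsilon>.\<close>

lemma lipschitz_approximate_extension:
  fixes M :: "'a::euclidean_space set"
  assumes "M \<noteq> {}"
  shows "\<exists>C\<ge>0. \<forall>\<epsilon>>0. \<exists>E :: ('a \<Rightarrow> real) \<Rightarrow> 'a \<Rightarrow> real.
    (\<forall>f g. E (f + g) = E f + E g) \<and> (\<forall>c f. E (\<lambda>x. c * f x) = (\<lambda>x. c * E f x)) \<and>
    (\<forall>L f. L-lipschitz_on M f \<longrightarrow> (C * L)-lipschitz_on UNIV (E f) \<and> (\<forall>m\<in>M. \<bar>E f m - f m\<bar> \<le> L * (8 * \<epsilon>)))"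
proof -
  have "(0::real) < 1 / 48" by simp
  from packing_bound[OF this] obtain N where N: "\<And>(x :: 'a) r S. 0 < r \<Longrightarrow> S \<subseteq> cball x r \<Longrightarrow>
    \<forall>p\<in>S. \<forall>q\<in>S. p \<noteq> q \<longrightarrow> 1 / 48 * r \<le> dist p q \<Longrightarrow> finite S \<and> card S \<le> N" by metis
  have "\<exists>E :: ('a \<Rightarrow> real) \<Rightarrow> 'a \<Rightarrow> real.
    (\<forall>f g. E (f + g) = E f + E g) \<and> (\<forall>c f. E (\<lambda>x. c * f x) = (\<lambda>x. c * E f x)) \<and>
    (\<forall>L f. L-lipschitz_on M f \<longrightarrow> ((80 * real N + 49) * L)-lipschitz_on UNIV (E f) \<and>
      (\<forall>m\<in>M. \<bar>E f m - f m\<bar> \<le> L * (8 * \<epsilon>)))"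
    if "0 < \<epsilon>" for \<epsilon>
  proof -
    define d where "d x = max \<epsilon> (infdist x M)" for x
    have d_pos: "0 < d x" for x using that by (simp add: d_def)
    obtain P where P: "\<And>p q. p \<in> P \<Longrightarrow> q \<in> P \<Longrightarrow> p \<noteq> q \<Longrightarrow> max (d p) (d q) / 8 \<le> dist p q"
      "\<And>x. \<exists>p\<in>P. dist x p < max (d x) (d p) / 8"
      using maximal_separated_set[of "\<lambda>x y. max (d x) (d y) / 8"] d_pos
      by (auto simp: max.commute less_max_iff_disj)
    have "\<exists>m\<in>M. dist x m \<le> 2 * d x" for x
    proof -
      have "infdist x M < 2 * d x" using d_pos[of x] by (auto simp: d_def)
      then show ?thesis using \<open>M \<noteq> {}\<close> cInf_lessD[of "dist x ` M" "2 * d x"]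
        by (force simp: infdist_notempty)
    qed
    then obtain \<pi> where \<pi>: "\<And>x. \<pi> x \<in> M" "\<And>x. dist x (\<pi> x) \<le> 2 * d x" by metis
    interpret whitney_net M P d \<pi> N
    proof
      show "d x \<le> d y + dist x y" for x y
        using infdist_triangle[of x M y] zero_le_dist[of x y] unfolding d_def by linarith
    qed (use d_pos \<pi> P N in auto)
    have "ext (f + g) = ext f + ext g" for f g
      by (simp add: ext_def fun_eq_iff distrib_left sum.distrib add_divide_distrib)
    moreover have "ext (\<lambda>x. c * f x) = (\<lambda>x. c * ext f x)" for c f
      by (simp add: ext_def fun_eq_iff sum_distrib_left mult.left_commute)
    moreover have "\<bar>ext f m - f m\<bar> \<le> L * (8 * \<epsilon>)" if "L-lipschitz_on M f" "m \<in> M" for L f m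
      using ext_approx[OF that, of m] that(2) \<open>0 < \<epsilon>\<close> by (simp add: d_def)
    ultimately show ?thesis using ext_lipschitz by blast
  qed
  then show ?thesis by (intro exI[of _ "80 * real N + 49"] conjI allI impI) simp_all
qed

lemma lipschitz_linear_extension:
  fixes M :: "'a::euclidean_space set"
  assumes "M \<noteq> {}"
  shows "\<exists>C. \<exists>E :: ('a \<Rightarrow> real) \<Rightarrow> 'a \<Rightarrow> real. 0 \<le> C \<and>
    (\<forall>K L f g. K-lipschitz_on M f \<longrightarrow> L-lipschitz_on M g \<longrightarrow> E (f + g) = E f + E g) \<and>
    (\<forall>L c f. L-lipschitz_on M f \<longrightarrow> E (\<lambda>x. c * f x) = (\<lambda>x. c * E f x)) \<and>
    (\<forall>L f. L-lipschitz_on M f \<longrightarrow> (C * L)-lipschitz_on UNIV (E f) \<and> (\<forall>m\<in>M. E f m = f m))"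
proof -
  obtain C where C: "0 \<le> C" and approx_ext: "\<forall>\<epsilon>>0. \<exists>E :: ('a \<Rightarrow> real) \<Rightarrow> 'a \<Rightarrow> real.
    (\<forall>f g. E (f + g) = E f + E g) \<and> (\<forall>c f. E (\<lambda>x. c * f x) = (\<lambda>x. c * E f x)) \<and>
    (\<forall>L f. L-lipschitz_on M f \<longrightarrow> (C * L)-lipschitz_on UNIV (E f) \<and> (\<forall>m\<in>M. \<bar>E f m - f m\<bar> \<le> L * (8 * \<epsilon>)))"
    using lipschitz_approximate_extension[OF assms] by blast
  have "\<forall>j. \<exists>E :: ('a \<Rightarrow> real) \<Rightarrow> 'a \<Rightarrow> real.
    (\<forall>f g. E (f + g) = E f + E g) \<and> (\<forall>c f. E (\<lambda>x. c * f x) = (\<lambda>x. c * E f x)) \<and>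
    (\<forall>L f. L-lipschitz_on M f \<longrightarrow> (C * L)-lipschitz_on UNIV (E f) \<and>
      (\<forall>m\<in>M. \<bar>E f m - f m\<bar> \<le> L * (8 * (1 / real (Suc j)))))"
    by (rule allI, rule mp[OF spec[OF approx_ext]]) simp
  from choice[OF this] obtain E :: "nat \<Rightarrow> ('a \<Rightarrow> real) \<Rightarrow> 'a \<Rightarrow> real" where E_all: "\<forall>j.
    (\<forall>f g. E j (f + g) = E j f + E j g) \<and> (\<forall>c f. E j (\<lambda>x. c * f x) = (\<lambda>x. c * E j f x)) \<and>
    (\<forall>L f. L-lipschitz_on M f \<longrightarrow> (C * L)-lipschitz_on UNIV (E j f) \<and>
      (\<forall>m\<in>M. \<bar>E j f m - f m\<bar> \<le> L * (8 * (1 / real (Suc j)))))" by (elim exE)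
  have E: "E j (f + g) = E j f + E j g" "E j (\<lambda>x. c * f x) = (\<lambda>x. c * E j f x)"
    and lip: "L-lipschitz_on M f \<Longrightarrow> (C * L)-lipschitz_on UNIV (E j f)"
    and approx: "L-lipschitz_on M f \<Longrightarrow> m \<in> M \<Longrightarrow> \<bar>E j f m - f m\<bar> \<le> L * (8 * (1 / real (Suc j)))"
    for j f g c L m
    using spec[OF E_all, of j] by (simp_all del: of_nat_Suc)
  have lim: "(\<lambda>j. L * (8 * (1 / real (Suc j)))) \<longlonglongrightarrow> 0" for L
    by (intro tendsto_mult_right_zero LIMSEQ_Suc[OF lim_1_over_n])
  have conv: "(\<lambda>j. E j f m) \<longlonglongrightarrow> f m" if "L-lipschitz_on M f" "m \<in> M" for L f m
  proof -
    have "(\<lambda>j. E j f m - f m) \<longlonglongrightarrow> 0"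
      by (rule Lim_null_comparison[OF _ lim[of L]]) (use approx[OF that] in simp)
    then show ?thesis by (simp add: LIM_zero_iff)
  qed
  have bdd: "Bseq (\<lambda>j. E j f x)" if f: "L-lipschitz_on M f" for L f x
  proof -
    obtain a where a: "a \<in> M" using assms by blast
    from conv[OF f a] have "Bseq (\<lambda>j. E j f a)" by (intro convergent_imp_Bseq convergentI)
    then obtain K where K: "\<And>j. \<bar>E j f a\<bar> \<le> K" by (auto simp: Bseq_def)
    have "\<bar>E j f x\<bar> \<le> C * L * dist x a + K" for j
      using lipschitz_onD[OF lip[OF f], of x a j] K[of j] by (simp add: dist_real_def)
    then show ?thesis by (intro BseqI') simp
  qed
  define G where "G f x = glim (\<lambda>j. E j f x)" for f x
  have add: "G (f + g) = G f + G g" if "K-lipschitz_on M f" "L-lipschitz_on M g" for K L f g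
    unfolding G_def using glim_add[OF bdd[OF that(1)] bdd[OF that(2)]] by (auto simp: E fun_eq_iff)
  have cmult: "G (\<lambda>x. c * f x) = (\<lambda>x. c * G f x)" if "L-lipschitz_on M f" for L c f
    unfolding G_def using glim_cmult[OF bdd[OF that]] by (auto simp: E fun_eq_iff)
  have lip_G: "(C * L)-lipschitz_on UNIV (G f)" if f: "L-lipschitz_on M f" for L f
  proof (rule lipschitz_onI)
    show "0 \<le> C * L" using C lipschitz_on_nonneg[OF f] by simp
    show "dist (G f x) (G f y) \<le> C * L * dist x y" for x y
      unfolding dist_real_def G_def
      by (rule glim_abs_diff_le[OF bdd[OF f] bdd[OF f] tendsto_const])
        (use lipschitz_onD[OF lip[OF f], of x y] in \<open>simp add: dist_real_def\<close>)
  qed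
  have eq: "G f m = f m" if "L-lipschitz_on M f" "m \<in> M" for L f m
    unfolding G_def using conv[OF that] by (rule glim_eq_limit)
  show ?thesis
  proof (rule exI[of _ C], rule exI[of _ G], intro conjI allI impI ballI)
    show "0 \<le> C" by (rule C)
  qed (fact add cmult lip_G eq)+
qed

section \<open>Lipschitz spaces: the norm and complementation\<close>

lemma lipschitz_imp_lip_norm_le:
  assumes f: "C-lipschitz_on X f"
  shows "lip_norm X f \<le> C"
  unfolding lip_norm_def
proof (rule cSup_least)
  fix t assume "t \<in> insert 0 {(f x - f y) / dist x y | x y. x \<in> X \<and> y \<in> X \<and> x \<noteq> y}"
  then consider "t = 0" | x y where "t = (f x - f y) / dist x y" "x \<in> X" "y \<in> X" "x \<noteq> y" by blast
  then show "t \<le> C"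
  proof cases
    case 1
    then show ?thesis using lipschitz_on_nonneg[OF f] by simp
  next
    case 2
    have "f x - f y \<le> C * dist x y" using lipschitz_onD[OF f 2(2,3)] by (simp add: dist_real_def)
    then show ?thesis using 2 by (simp add: pos_divide_le_eq)
  qed
qed simp

lemma lip_norm_nonneg:
  assumes "f \<in> Lip0 X a"
  shows "0 \<le> lip_norm X f"
proof (cases "\<exists>x\<in>X. \<exists>y\<in>X. x \<noteq> y")
  case True
  then obtain x y where xy: "x \<in> X" "y \<in> X" "x \<noteq> y" by blast
  then have "0 \<le> lip_norm X f * dist x y"
    using lip_norm_upper[OF assms xy] lip_norm_upper[OF assms xy(2,1)]
    by (simp add: pos_divide_le_eq dist_commute)
  then show ?thesis using xy by (simp add: zero_le_mult_iff)
next
  case False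
  then have "{(f x - f y) / dist x y | x y. x \<in> X \<and> y \<in> X \<and> x \<noteq> y} = {}" by blast
  then show ?thesis by (simp only: lip_norm_def cSup_singleton order_refl)
qed

lemma Lip0_lipschitz_on:
  assumes f: "f \<in> Lip0 X a"
  shows "(lip_norm X f)-lipschitz_on X f"
proof (rule lipschitz_onI)
  show "dist (f x) (f y) \<le> lip_norm X f * dist x y" if "x \<in> X" "y \<in> X" for x y
  proof (cases "x = y")
    case False
    then show ?thesis
      using lip_norm_upper[OF f that False] lip_norm_upper[OF f that(2,1)]
      by (simp add: divide_simps dist_real_def dist_commute abs_le_iff)
  qed simp
qed (rule lip_norm_nonneg[OF f])

lemma Lip0_base: "f \<in> Lip0 X a \<Longrightarrow> f a = 0"
  by (simp add: Lip0_def)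

lemma fun_space_Lip0: "fun_space (Lip0 X a) (lip_norm X)"
proof (rule fun_spaceI)
  show "0 \<in> Lip0 X a" by (auto simp: Lip0_def zero_fun_def intro: lipschitz_on_constant)
  show "f + g \<in> Lip0 X a \<and> lip_norm X (f + g) \<le> lip_norm X f + lip_norm X g"
    if "f \<in> Lip0 X a" "g \<in> Lip0 X a" for f g
    using Lip0_add[OF that] lipschitz_on_add[OF Lip0_lipschitz_on[OF that(1)] Lip0_lipschitz_on[OF that(2)]]
    by (auto simp: plus_fun_def intro: lipschitz_imp_lip_norm_le)
  show "(\<lambda>x. c * f x) \<in> Lip0 X a \<and> lip_norm X (\<lambda>x. c * f x) \<le> \<bar>c\<bar> * lip_norm X f"
    if "f \<in> Lip0 X a" for c f
    using Lip0_cmult[OF that] lipschitz_on_cmult_real[OF Lip0_lipschitz_on[OF that], of c]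
    by (auto intro: lipschitz_imp_lip_norm_le)
qed (rule lip_norm_nonneg)

lemma Lip0_rebase:
  assumes f: "C-lipschitz_on X f" and a: "a \<in> X"
  shows "(\<lambda>x. if x \<in> X then f x - f a else 0) \<in> Lip0 X a"
    "lip_norm X (\<lambda>x. if x \<in> X then f x - f a else 0) \<le> C"
proof -
  have *: "C-lipschitz_on X (\<lambda>x. if x \<in> X then f x - f a else 0)"
    using lipschitz_onD[OF f] lipschitz_on_nonneg[OF f] by (intro lipschitz_onI) (auto simp: dist_real_def)
  then show "(\<lambda>x. if x \<in> X then f x - f a else 0) \<in> Lip0 X a"
    using a unfolding Lip0_def by auto
  show "lip_norm X (\<lambda>x. if x \<in> X then f x - f a else 0) \<le> C"
    by (rule lipschitz_imp_lip_norm_le[OF *])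
qed

text \<open>Extension and restriction, each followed by subtracting a constant to respect the base
  points; the constants cancel in \<open>B (A f)\<close> because \<open>f a = 0\<close>.\<close>

lemma Lip0_complemented_in_UNIV:
  fixes M :: "'a::euclidean_space set" and b :: 'a
  assumes a: "a \<in> M"
  shows "\<exists>K L A B. bounded_op K (Lip0 M a) (lip_norm M) (Lip0 UNIV b) (lip_norm UNIV) A \<and>
    bounded_op L (Lip0 UNIV b) (lip_norm UNIV) (Lip0 M a) (lip_norm M) B \<and>
    (\<forall>f\<in>Lip0 M a. B (A f) = f)"
proof -
  have "M \<noteq> {}" using a by blast
  from lipschitz_linear_extension[OF this] obtain C and E :: "('a \<Rightarrow> real) \<Rightarrow> 'a \<Rightarrow> real" where C: "0 \<le> C" and E_all:
    "\<forall>K L f g. K-lipschitz_on M f \<longrightarrow> L-lipschitz_on M g \<longrightarrow> E (f + g) = E f + E g"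
    "\<forall>L c f. L-lipschitz_on M f \<longrightarrow> E (\<lambda>x. c * f x) = (\<lambda>x. c * E f x)"
    "\<forall>L f. L-lipschitz_on M f \<longrightarrow> (C * L)-lipschitz_on UNIV (E f) \<and> (\<forall>m\<in>M. E f m = f m)"
    by (elim exE conjE)
  note E = E_all(1)[rule_format] E_all(2)[rule_format] conjunct1[OF E_all(3)[rule_format]]
    bspec[OF conjunct2[OF E_all(3)[rule_format]]]
  define A where "A f = (\<lambda>x. if x \<in> UNIV then E f x - E f b else 0)" for f
  define B where "B f = (\<lambda>x. if x \<in> M then f x - f a else 0)" for f :: "'a \<Rightarrow> real"
  note lip = Lip0_lipschitz_on[of _ M a]
  have "bounded_op C (Lip0 M a) (lip_norm M) (Lip0 UNIV b) (lip_norm UNIV) A"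
    unfolding bounded_op_def
  proof (intro conjI ballI allI C)
    fix f assume f: "f \<in> Lip0 M a"
    show "A f \<in> Lip0 UNIV b" "lip_norm UNIV (A f) \<le> C * lip_norm M f"
      unfolding A_def by (rule Lip0_rebase[OF E(3)[OF lip[OF f]] UNIV_I])+
    show "A (\<lambda>x. c * f x) = (\<lambda>y. c * A f y)" for c
      unfolding A_def E(2)[OF lip[OF f]] by (simp add: fun_eq_iff algebra_simps)
    show "A (f + g) = A f + A g" if g: "g \<in> Lip0 M a" for g
      unfolding A_def E(1)[OF lip[OF f] lip[OF g]] by (simp add: fun_eq_iff)
  qed
  moreover have "bounded_op 1 (Lip0 UNIV b) (lip_norm UNIV) (Lip0 M a) (lip_norm M) B"
    unfolding bounded_op_def
  proof (intro conjI ballI allI)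
    fix f assume f: "f \<in> Lip0 UNIV b"
    have "(1 * lip_norm UNIV f)-lipschitz_on M f"
      using lipschitz_on_subset[OF Lip0_lipschitz_on[OF f]] by simp
    then show "B f \<in> Lip0 M a" "lip_norm M (B f) \<le> 1 * lip_norm UNIV f"
      unfolding B_def by (rule Lip0_rebase[OF _ a])+
  qed (auto simp: B_def fun_eq_iff algebra_simps)
  moreover have "B (A f) = f" if "f \<in> Lip0 M a" for f
    using E(4)[OF lip[OF that]] Lip0_base[OF that] a that
    by (auto simp: A_def B_def fun_eq_iff Lip0_def)
  ultimately show ?thesis by blast
qed

section \<open>Disjoint balls in which a non-porous set is dense\<close>

definition dense_ball :: "'a::metric_space set \<Rightarrow> real \<Rightarrow> 'a \<Rightarrow> real \<Rightarrow> bool" where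
  "dense_ball M e q s \<longleftrightarrow> 0 < s \<and> (\<forall>x\<in>cball q s. \<exists>m\<in>M. dist x m \<le> e * s)"

text \<open>The doubled ball has to fit because functions written into a ball fade out between the
  radii \<open>s\<close> and \<open>2 * s\<close>.\<close>

definition rich :: "'a::metric_space set \<Rightarrow> 'a set \<Rightarrow> bool" where
  "rich M U \<longleftrightarrow> (\<forall>e>0. \<exists>q s. dense_ball M e q s \<and> cball q (2 * s) \<subseteq> U)"

text \<open>Failure of porosity at \<open>c\<close> gives a ball of radius \<open>r\<close> in which
  every sub-ball of radius \<open>c * r\<close> meets \<open>M\<close>. Points of the concentric
  ball of radius \<open>(1 - c) * r\<close> are centres of such sub-balls.\<close>

lemma not_porous_imp_rich:
  fixes M :: "(real ^ 'n) set"
  assumes "\<not> porous_in UNIV M"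
  shows "rich M UNIV"
  unfolding rich_def
proof (intro allI impI)
  fix e :: real assume "0 < e"
  \<comment> \<open>The bound \<open>1 / 2\<close> keeps the shrunk radius \<open>s\<close> at least
    \<open>r / 2\<close>, and then \<open>e / 2\<close> makes \<open>c * r\<close> at most
    \<open>e * s\<close>.\<close>
  define c where "c = min (e / 2) (1 / 2)"
  have c: "0 < c" "c \<le> 1 / 2" "2 * c \<le> e" using \<open>0 < e\<close> by (auto simp: c_def)
  with assms obtain p r where r: "0 < r" and pr: "\<And>x. \<not> cball x (c * r) \<subseteq> cball p r - M"
    unfolding porous_in_UNIV_iff by blast
  define s where "s = (1 - c) * r"
  have s: "0 < s" "c * r \<le> e * s"
  proof -
    show "0 < s" using c r by (simp add: s_def)
    have "1 * r \<le> 2 * (1 - c) * r" using c r by (intro mult_right_mono) auto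
    then have "r \<le> 2 * s" by (simp only: s_def mult.assoc mult_1)
    then have "c * r \<le> c * (2 * s)" using c by (intro mult_left_mono) auto
    also have "\<dots> \<le> e * s" using c(3) \<open>0 < s\<close> by (simp add: mult_right_mono mult.assoc[symmetric] mult.commute)
    finally show "c * r \<le> e * s" .
  qed
  have "\<exists>m\<in>M. dist x m \<le> e * s" if x: "x \<in> cball p s" for x
  proof -
    have "cball x (c * r) \<subseteq> cball p r"
      using x by (intro cball_subset_cball_iff[THEN iffD2] disjI1) (simp add: s_def dist_commute algebra_simps)
    then obtain m where "m \<in> M" "m \<in> cball x (c * r)" using pr[of x] by blast
    then show ?thesis using s(2) by (intro bexI[of _ m]) auto
  qed
  then show "\<exists>q s. dense_ball M e q s \<and> cball q (2 * s) \<subseteq> UNIV"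
    using s(1) unfolding dense_ball_def by blast
qed

lemma dense_ball_shrink:
  fixes q :: "'a::euclidean_space"
  assumes "dense_ball M e q s" "0 < t" "dist q' q + t * s \<le> s" "e / t \<le> e'"
  shows "dense_ball M e' q' (t * s)"
  unfolding dense_ball_def
proof (intro conjI ballI)
  have s: "0 < s" using assms(1) by (simp add: dense_ball_def)
  show "0 < t * s" using s assms(2) by simp
  fix x assume "x \<in> cball q' (t * s)"
  then have "x \<in> cball q s"
    using assms(3) dist_triangle[of q x q'] by (simp add: dist_commute)
  then obtain m where "m \<in> M" "dist x m \<le> e * s" using assms(1) unfolding dense_ball_def by blast
  moreover have "e * s \<le> e' * (t * s)"
  proof -
    have "e \<le> e' * t" using assms(2,4) by (simp add: pos_divide_le_eq)
    then show ?thesis using s mult_right_mono[of e "e' * t" s] by (simp add: mult.assoc)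
  qed
  ultimately show "\<exists>m\<in>M. dist x m \<le> e' * (t * s)" by force
qed

text \<open>Of two small balls that are far apart, at least one can be removed without destroying
  richness: any other ball has a sub-ball of comparable size that avoids one of the two.\<close>

lemma rich_remove_ball:
  fixes M U :: "'a::euclidean_space set"
  assumes rich: "rich M U" and "0 < e"
  shows "\<exists>q s. dense_ball M e q s \<and> cball q (2 * s) \<subseteq> U \<and> rich M (U - cball q (2 * s))"
proof -
  obtain u :: 'a where u: "norm u = 1" using norm_Basis SOME_Basis by blast
  have "0 < e / 8" using \<open>0 < e\<close> by simp
  then obtain q0 s0 where qs: "dense_ball M (e / 8) q0 s0" "cball q0 (2 * s0) \<subseteq> U"
    using rich unfolding rich_def by blast
  have s0: "0 < s0" using qs(1) by (simp add: dense_ball_def)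
  \<comment> \<open>The two candidates have radius \<open>s0 / 8\<close>, which costs the factor 8
    in density; their doubles, of radius \<open>s0 / 4\<close>, are \<open>s0 / 2\<close>
    apart.\<close>
  define q1 where "q1 = q0 + (s0 / 2) *\<^sub>R u"
  define q2 where "q2 = q0 - (s0 / 2) *\<^sub>R u"
  have d1: "dist q1 q0 = s0 / 2" and d2: "dist q2 q0 = s0 / 2" using u s0 by (simp_all add: q1_def q2_def dist_norm)
  have "q1 - q2 = s0 *\<^sub>R u" by (simp add: q1_def q2_def algebra_simps flip: scaleR_add_left)
  then have d12: "dist q1 q2 = s0" using u s0 by (simp add: dist_norm)
  have balls: "dense_ball M e q (1 / 8 * s0) \<and> cball q (2 * (1 / 8 * s0)) \<subseteq> U" if "dist q q0 = s0 / 2" for q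
  proof
    show "dense_ball M e q (1 / 8 * s0)" using that s0 by (intro dense_ball_shrink[OF qs(1)]) auto
    have "cball q (2 * (1 / 8 * s0)) \<subseteq> cball q0 (2 * s0)"
    proof
      fix x assume "x \<in> cball q (2 * (1 / 8 * s0))"
      then show "x \<in> cball q0 (2 * s0)" using that dist_triangle[of q0 x q] s0 by (simp add: dist_commute)
    qed
    then show "cball q (2 * (1 / 8 * s0)) \<subseteq> U" using qs(2) by blast
  qed
  have "rich M (U - cball q1 (2 * (1 / 8 * s0))) \<or> rich M (U - cball q2 (2 * (1 / 8 * s0)))"
  proof (rule ccontr)
    assume "\<not> ?thesis"
    then obtain e1 e2 where e: "0 < e1" "0 < e2"
      and no1: "\<And>q s. dense_ball M e1 q s \<Longrightarrow> \<not> cball q (2 * s) \<subseteq> U - cball q1 (2 * (1 / 8 * s0))"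
      and no2: "\<And>q s. dense_ball M e2 q s \<Longrightarrow> \<not> cball q (2 * s) \<subseteq> U - cball q2 (2 * (1 / 8 * s0))"
      unfolding rich_def by blast
    \<comment> \<open>Shrinking to \<open>1 / 20\<close> of the radius costs the factor 20 in
      density, so such sub-balls of an \<open>e3\<close>-dense ball are dense enough for both
      \<open>e1\<close> and \<open>e2\<close>.\<close>
    define e3 where "e3 = min e1 e2 / 20"
    have "0 < e3" using e by (simp add: e3_def)
    then obtain q t where qt: "dense_ball M e3 q t" "cball q (2 * t) \<subseteq> U"
      using rich unfolding rich_def by blast
    have t: "0 < t" using qt(1) by (simp add: dense_ball_def)
    have sub: "dense_ball M e1 p (1 / 20 * t) \<and> dense_ball M e2 p (1 / 20 * t) \<and> cball p (2 * (1 / 20 * t)) \<subseteq> U"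
      if p: "dist p q \<le> 7 / 8 * t" for p
    proof (intro conjI)
      show "dense_ball M e1 p (1 / 20 * t)" "dense_ball M e2 p (1 / 20 * t)"
        using p t by (intro dense_ball_shrink[OF qt(1)]; simp add: e3_def)+
      have "cball p (2 * (1 / 20 * t)) \<subseteq> cball q (2 * t)"
      proof
        fix x assume "x \<in> cball p (2 * (1 / 20 * t))"
        then show "x \<in> cball q (2 * t)" using p dist_triangle[of q x p] t by (simp add: dist_commute)
      qed
      then show "cball p (2 * (1 / 20 * t)) \<subseteq> U" using qt(2) by blast
    qed
    \<comment> \<open>The doubled central sub-ball lies in \<open>U\<close> and so must meet both
      doubled candidates; the gap between them then bounds \<open>s0\<close> by
      \<open>t\<close>.\<close>
    have "dist q q \<le> 7 / 8 * t" using t by simp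
    from sub[OF this] no1[of q "1 / 20 * t"] no2[of q "1 / 20 * t"]
    obtain x y where x: "dist q x \<le> t / 10" "dist q1 x \<le> s0 / 4" and y: "dist q y \<le> t / 10" "dist q2 y \<le> s0 / 4"
      by (auto simp: subset_iff)
    have "dist q1 q2 \<le> dist q1 x + dist q x + (dist q y + dist q2 y)"
      using dist_triangle[of q1 q2 q] dist_triangle2[of q1 q x] dist_triangle2[of q q2 y]
      by (simp add: dist_commute)
    then have ts: "s0 \<le> t" using x y d12 t s0 by linarith
    \<comment> \<open>The doubled first candidate reaches the doubled central sub-ball and has
      diameter at most \<open>t / 2\<close>, so it cannot also reach the doubled sub-ball around
      \<open>p\<close>. That sub-ball contradicts the choice of \<open>e1\<close>.\<close>
    define p where "p = q + (7 / 8 * t) *\<^sub>R u"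
    have pq: "dist p q = 7 / 8 * t" using u t by (simp add: p_def dist_norm)
    have "z \<notin> cball q1 (2 * (1 / 8 * s0))" if z: "z \<in> cball p (2 * (1 / 20 * t))" for z
    proof
      assume "z \<in> cball q1 (2 * (1 / 8 * s0))"
      then have "dist q1 z \<le> s0 / 4" by simp
      moreover have "dist p z \<le> t / 10" using z by simp
      moreover have "dist p q \<le> dist p z + dist q1 z + dist q1 x + dist q x"
        using dist_triangle[of p q z] dist_triangle[of z q q1] dist_triangle[of q1 q x]
        by (simp add: dist_commute)
      ultimately show False using pq x ts t s0 by linarith
    qed
    then show False using sub[of p] no1[of p "1 / 20 * t"] pq by auto
  qed
  then show ?thesis using balls[OF d1] balls[OF d2] by blast
qed

lemma disjoint_dense_balls:
  fixes M :: "'a::euclidean_space set"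
  assumes rich: "rich M UNIV" and pos: "\<And>n. 0 < e n"
  shows "\<exists>q s. (\<forall>n::nat. dense_ball M (e n) (q n) (s n)) \<and>
    (\<forall>i j. i \<noteq> j \<longrightarrow> cball (q i) (2 * s i) \<inter> cball (q j) (2 * s j) = {})"
proof -
  \<comment> \<open>The state is the remaining region with a ball chosen in it; richness of the
    region after removal of that ball is the invariant that permits the next choice.\<close>
  let ?P = "\<lambda>n (U, q, s). dense_ball M (e n) q s \<and> cball q (2 * s) \<subseteq> U \<and> rich M (U - cball q (2 * s))"
  let ?Q = "\<lambda>(n::nat) (U, q, s) (U', q' :: 'a, s' :: real). U' = U - cball q (2 * s)"
  have "\<exists>f. \<forall>n. ?P n (f n) \<and> ?Q n (f n) (f (Suc n))"
  proof (rule dependent_nat_choice)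
    show "\<exists>x. ?P 0 x" using rich_remove_ball[OF rich pos[of 0]] by auto
  next
    fix x :: "'a set \<times> 'a \<times> real" and n assume x: "?P n x"
    obtain U q s where [simp]: "x = (U, q, s)" by (cases x)
    have "rich M (U - cball q (2 * s))" using x by simp
    from rich_remove_ball[OF this pos[of "Suc n"]] show "\<exists>y. ?P (Suc n) y \<and> ?Q n x y" by auto
  qed
  then obtain f where f: "\<forall>n. ?P n (f n) \<and> ?Q n (f n) (f (Suc n))" by (elim exE)
  define U where "U n = fst (f n)" for n
  define q where "q n = fst (snd (f n))" for n
  define s where "s n = snd (snd (f n))" for n
  have P: "dense_ball M (e n) (q n) (s n)" "cball (q n) (2 * s n) \<subseteq> U n"
    and Q: "U (Suc n) = U n - cball (q n) (2 * s n)" for n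
    using f[rule_format, of n] by (auto simp: U_def q_def s_def split: prod.splits)
  have anti: "U n \<subseteq> U m" if "m \<le> n" for m n
    using that by (rule lift_Suc_antimono_le[rotated]) (use Q in auto)
  have disj: "cball (q i) (2 * s i) \<inter> cball (q j) (2 * s j) = {}" if "i < j" for i j
    using P(2)[of j] anti[of "Suc i" j] Q[of i] that by auto
  have "cball (q i) (2 * s i) \<inter> cball (q j) (2 * s j) = {}" if "i \<noteq> j" for i j
    using disj[of i j] disj[of j i] that by (cases "i < j") auto
  then show ?thesis using P(1) by blast
qed

section \<open>Blow-ups\<close>

lemma dist_mult_real:
  fixes c :: real
  assumes "0 \<le> c"
  shows "dist (c * u) (c * v) = c * dist u v"
  using assms by (simp add: dist_real_def abs_mult flip: right_diff_distrib)

text \<open>Since \<open>f\<close> vanishes at the centre, it is at most \<open>2 * s * L\<close> in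
  absolute value where \<open>w\<close> is nonzero, which offsets the slope \<open>1 / s\<close> of
  \<open>w\<close>. The product rule gives \<open>1 + 2 = 3\<close>.\<close>

lemma cutoff_lipschitz:
  fixes f w :: "'a::metric_space \<Rightarrow> real"
  assumes f: "L-lipschitz_on UNIV f" and s: "0 < s" and fq: "f q = 0"
    and w: "\<And>x. 0 \<le> w x" "\<And>x. w x \<le> 1" "\<And>x y. \<bar>w x - w y\<bar> \<le> dist x y / s"
    and off: "\<And>x. 2 * s < dist q x \<Longrightarrow> w x = 0"
  shows "(3 * L)-lipschitz_on UNIV (\<lambda>x. w x * f x)"
proof (rule lipschitz_onI)
  have L: "0 \<le> L" using lipschitz_on_nonneg[OF f] .
  then show "0 \<le> 3 * L" by simp
  have f': "\<bar>f x - f y\<bar> \<le> L * dist x y" for x y using lipschitz_onD[OF f, of x y] by (simp add: dist_real_def)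
  have *: "\<bar>w x * f x - w y * f y\<bar> \<le> 3 * L * dist x y" if y: "dist q y \<le> 2 * s" for x y
  proof -
    have "\<bar>f y\<bar> \<le> L * dist q y" using f'[of y q] fq by (simp add: dist_commute)
    also have "\<dots> \<le> L * (2 * s)" using L y by (rule mult_left_mono[rotated])
    finally have fy: "\<bar>f y\<bar> \<le> L * (2 * s)" .
    have "w x * f x - w y * f y = w x * (f x - f y) + (w x - w y) * f y" by (simp add: algebra_simps)
    then have "\<bar>w x * f x - w y * f y\<bar> \<le> w x * \<bar>f x - f y\<bar> + \<bar>w x - w y\<bar> * \<bar>f y\<bar>"
      using abs_triangle_ineq[of "w x * (f x - f y)" "(w x - w y) * f y"] w(1)[of x] by (simp add: abs_mult)
    also have "\<dots> \<le> 1 * (L * dist x y) + dist x y / s * (L * (2 * s))"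
      using w[of x] f' fy s L by (intro add_mono mult_mono) auto
    also have "\<dots> = 3 * L * dist x y" using s by (simp add: field_simps)
    finally show ?thesis .
  qed
  fix x y
  show "dist (w x * f x) (w y * f y) \<le> 3 * L * dist x y"
  proof (cases "dist q x \<le> 2 * s \<or> dist q y \<le> 2 * s")
    case True
    then show ?thesis using *[of x y] *[of y x] by (auto simp: dist_real_def dist_commute abs_minus_commute)
  next
    case False
    then show ?thesis using off[of x] off[of y] L by simp
  qed
qed

text \<open>Magnified by \<open>(k + 1) / s k\<close>, the \<open>k\<close>-th ball gets radius
  \<open>k + 1\<close>, while the distance to \<open>M\<close> inside it shrinks to at most
  \<open>1 / (k + 1)\<close>: the magnified balls exhaust the space and the error still vanishes.
  This is the reason for the square.\<close>

locale blow_up_balls =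
  fixes M :: "'a::euclidean_space set" and a b :: 'a and q :: "nat \<Rightarrow> 'a" and s :: "nat \<Rightarrow> real"
  assumes a: "a \<in> M"
    and dense: "dense_ball M (1 / real (Suc k) ^ 2) (q k) (s k)"
    and disjoint: "i \<noteq> j \<Longrightarrow> cball (q i) (2 * s i) \<inter> cball (q j) (2 * s j) = {}"
begin

definition R :: "nat \<Rightarrow> real" where "R k = real (Suc k)"

definition cutoff :: "nat \<Rightarrow> 'a \<Rightarrow> real" where
  "cutoff k x = max 0 (min 1 (2 - dist (q k) x / s k))"

text \<open>The first component of \<open>prod_decode k\<close> selects the function to copy, so
  each one occurs in infinitely many balls. Values are scaled inversely to arguments, which keeps
  Lipschitz constants, and the centre goes to \<open>b\<close>, where the functions to be copied
  vanish.\<close>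

definition rescaled :: "(nat \<times> 'a \<Rightarrow> real) \<Rightarrow> nat \<Rightarrow> 'a \<Rightarrow> real" where
  "rescaled F k x = s k / R k * F (fst (prod_decode k), b + (R k / s k) *\<^sub>R (x - q k))"

text \<open>The junk value \<open>0\<close> outside all balls is harmless, as every cutoff vanishes there.\<close>

definition idx :: "'a \<Rightarrow> nat" where
  "idx x = (if \<exists>k. x \<in> cball (q k) (2 * s k) then SOME k. x \<in> cball (q k) (2 * s k) else 0)"

definition glue :: "(nat \<times> 'a \<Rightarrow> real) \<Rightarrow> 'a \<Rightarrow> real" where
  "glue F x = cutoff (idx x) x * rescaled F (idx x) x"

definition embed :: "(nat \<times> 'a \<Rightarrow> real) \<Rightarrow> 'a \<Rightarrow> real" where
  "embed F x = (if x \<in> M then glue F x - glue F a else 0)"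

text \<open>The point of the ball that corresponds to \<open>y\<close> may lie outside
  \<open>M\<close>, so a nearby point of \<open>M\<close> stands in for it. For \<open>y\<close>
  beyond the radius \<open>R k\<close> any point of \<open>M\<close> will do.\<close>

definition \<mu> :: "nat \<Rightarrow> 'a \<Rightarrow> 'a" where
  "\<mu> k y = (SOME m. m \<in> M \<and>
     (dist y b \<le> R k \<longrightarrow> dist (q k + (s k / R k) *\<^sub>R (y - b)) m \<le> s k / R k ^ 2))"

definition blow :: "('a \<Rightarrow> real) \<Rightarrow> nat \<Rightarrow> 'a \<Rightarrow> real" where
  "blow g k y = R k / s k * (g (\<mu> k y) - g (\<mu> k b))"

definition recover :: "('a \<Rightarrow> real) \<Rightarrow> nat \<times> 'a \<Rightarrow> real" where
  "recover g = (\<lambda>(i, y). glim (\<lambda>j. blow g (prod_encode (i, j)) y))"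

lemma s_pos: "0 < s k" and R_pos: "0 < R k"
  using dense[of k] by (auto simp: dense_ball_def R_def)

lemma mu: "\<mu> k y \<in> M" "dist y b \<le> R k \<Longrightarrow> dist (q k + (s k / R k) *\<^sub>R (y - b)) (\<mu> k y) \<le> s k / R k ^ 2"
proof -
  have "\<exists>m. m \<in> M \<and> (dist y b \<le> R k \<longrightarrow> dist (q k + (s k / R k) *\<^sub>R (y - b)) m \<le> s k / R k ^ 2)"
  proof (cases "dist y b \<le> R k")
    case True
    have "norm ((s k / R k) *\<^sub>R (y - b)) \<le> s k"
      using True s_pos[of k] R_pos[of k] by (simp only: norm_scaleR dist_norm) (simp add: field_simps)
    then have "q k + (s k / R k) *\<^sub>R (y - b) \<in> cball (q k) (s k)" by (simp add: dist_norm)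
    then show ?thesis using dense[of k] unfolding dense_ball_def R_def by fastforce
  next
    case False
    then show ?thesis using a by blast
  qed
  from someI_ex[OF this, folded \<mu>_def] show "\<mu> k y \<in> M"
    "dist y b \<le> R k \<Longrightarrow> dist (q k + (s k / R k) *\<^sub>R (y - b)) (\<mu> k y) \<le> s k / R k ^ 2" by blast+
qed

lemma idx_eq:
  assumes "x \<in> cball (q k) (2 * s k)"
  shows "idx x = k"
proof -
  have "x \<in> cball (q (idx x)) (2 * s (idx x))"
    unfolding idx_def using assms someI_ex[of "\<lambda>k. x \<in> cball (q k) (2 * s k)"] by auto
  then show ?thesis using disjoint[of "idx x" k] assms by blast
qed

lemma cutoff_off: "2 * s k < dist (q k) x \<Longrightarrow> cutoff k x = 0"
  using s_pos[of k] by (simp add: cutoff_def field_simps)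

lemma cutoff_idx: "k \<noteq> idx x \<Longrightarrow> cutoff k x = 0"
  using cutoff_off[of k x] idx_eq[of x k] by (cases "dist (q k) x \<le> 2 * s k") auto

lemma rescaled_lipschitz:
  assumes "L-lipschitz_on UNIV (\<lambda>y. F (fst (prod_decode k), y))"
  shows "L-lipschitz_on UNIV (rescaled F k)"
proof (rule lipschitz_onI)
  show "0 \<le> L" using lipschitz_on_nonneg[OF assms] .
  fix x y
  have "dist (rescaled F k x) (rescaled F k y) = s k / R k *
    dist (F (fst (prod_decode k), b + (R k / s k) *\<^sub>R (x - q k))) (F (fst (prod_decode k), b + (R k / s k) *\<^sub>R (y - q k)))"
    unfolding rescaled_def using s_pos[of k] R_pos[of k] by (intro dist_mult_real) simp
  also have "\<dots> \<le> s k / R k * (L * dist (b + (R k / s k) *\<^sub>R (x - q k)) (b + (R k / s k) *\<^sub>R (y - q k)))"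
    using s_pos[of k] R_pos[of k] by (intro mult_left_mono lipschitz_onD[OF assms]) auto
  also have "dist (b + (R k / s k) *\<^sub>R (x - q k)) (b + (R k / s k) *\<^sub>R (y - q k)) = R k / s k * dist x y"
    using s_pos[of k] R_pos[of k] by (simp add: dist_norm flip: scaleR_diff_right)
  finally show "dist (rescaled F k x) (rescaled F k y) \<le> L * dist x y"
    using s_pos[of k] R_pos[of k] by simp
qed

text \<open>At two points in different balls only two of the pieces are involved, and each vanishes
  at the other point. Each contributes \<open>3 * L\<close>.\<close>

lemma glue_lipschitz:
  assumes F: "\<And>i. L-lipschitz_on UNIV (\<lambda>y. F (i, y))" "\<And>i. F (i, b) = 0"
  shows "(6 * L)-lipschitz_on UNIV (glue F)"
proof (rule lipschitz_onI)
  define h where "h k x = cutoff k x * rescaled F k x" for k x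
  have "0 \<le> L" using lipschitz_on_nonneg[OF F(1)] .
  then show "0 \<le> 6 * L" by simp
  have cut: "\<bar>cutoff k x - cutoff k y\<bar> \<le> dist x y / s k" for k x y
  proof -
    have "\<bar>dist (q k) x / s k - dist (q k) y / s k\<bar> \<le> dist x y / s k"
      using s_pos[of k] dist_triangle[of "q k" x y] dist_triangle[of "q k" y x]
      by (simp add: dist_commute divide_right_mono flip: diff_divide_distrib)
    then show ?thesis by (auto simp: cutoff_def)
  qed
  have "(3 * L)-lipschitz_on UNIV (h k)" for k
    unfolding h_def
  proof (rule cutoff_lipschitz[OF rescaled_lipschitz[OF F(1)] s_pos _ _ _ cut cutoff_off])
    show "rescaled F k (q k) = 0" by (simp add: rescaled_def F(2))
  qed (auto simp: cutoff_def)
  then have h: "\<bar>h k x - h k y\<bar> \<le> 3 * L * dist x y" for k x y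
    using lipschitz_onD[of "3 * L" UNIV "h k" x y] by (simp add: dist_real_def)
  fix x y
  have "\<bar>h (idx x) x - h (idx y) y\<bar> \<le> 6 * L * dist x y"
  proof (cases "idx x = idx y")
    case True
    then show ?thesis using h[of "idx x" x y] \<open>0 \<le> L\<close> zero_le_dist[of x y] by (simp add: algebra_simps)
  next
    case False
    then have "h (idx x) y = 0" "h (idx y) x = 0" by (simp_all add: h_def cutoff_idx)
    then show ?thesis using h[of "idx x" x y] h[of "idx y" x y] by simp
  qed
  then show "dist (glue F x) (glue F y) \<le> 6 * L * dist x y"
    by (simp add: glue_def h_def dist_real_def)
qed

lemma bounded_op_embed:
  "bounded_op 6 (linf (Lip0 UNIV b) (lip_norm UNIV)) (linf_norm (lip_norm UNIV)) (Lip0 M a) (lip_norm M) embed"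
  unfolding bounded_op_def
proof (intro conjI ballI allI)
  fix F assume F: "F \<in> linf (Lip0 UNIV b) (lip_norm UNIV)"
  note comp = linf_component[OF F]
  have "(6 * linf_norm (lip_norm UNIV) F)-lipschitz_on M (glue F)"
  proof (rule lipschitz_on_subset[OF glue_lipschitz])
    show "(linf_norm (lip_norm UNIV) F)-lipschitz_on UNIV (\<lambda>y. F (i, y))" for i
      by (rule lipschitz_on_le[OF Lip0_lipschitz_on[OF comp(1)] comp(2)])
    show "F (i, b) = 0" for i using Lip0_base[OF comp(1)] .
  qed simp
  then show "embed F \<in> Lip0 M a" "lip_norm M (embed F) \<le> 6 * linf_norm (lip_norm UNIV) F"
    unfolding embed_def by (rule Lip0_rebase[OF _ a])+
qed (auto simp: embed_def glue_def rescaled_def fun_eq_iff algebra_simps)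

lemma R_encode: "real (Suc j) \<le> R (prod_encode (i, j))"
  using le_prod_encode_2[of j i] by (simp add: R_def)

lemma eventually_R_encode: "\<forall>\<^sub>F j in sequentially. t \<le> R (prod_encode (i, j))"
proof -
  obtain n where "t \<le> real n" using real_arch_simple by blast
  then have "t \<le> R (prod_encode (i, j))" if "n \<le> j" for j using R_encode[of j i] that by simp
  then show ?thesis by (auto simp: eventually_sequentially)
qed

lemma inverse_R_encode: "(\<lambda>j. c / R (prod_encode (i, j))) \<longlonglongrightarrow> 0"
proof (rule Lim_null_comparison)
  have "norm (c / R (prod_encode (i, j))) \<le> \<bar>c\<bar> * (1 / real (Suc j))" for j
    using R_encode[of j i] R_pos[of "prod_encode (i, j)"]
    by (simp add: abs_divide divide_left_mono del: of_nat_Suc)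
  then show "\<forall>\<^sub>F j in sequentially. norm (c / R (prod_encode (i, j))) \<le> \<bar>c\<bar> * (1 / real (Suc j))" by simp
  show "(\<lambda>j. \<bar>c\<bar> * (1 / real (Suc j))) \<longlonglongrightarrow> 0"
    by (intro tendsto_mult_right_zero LIMSEQ_Suc[OF lim_1_over_n])
qed

text \<open>Sampling in \<open>M\<close> displaces each of the two points by at most
  \<open>s k / R k ^ 2\<close>, which costs \<open>L / R k\<close> after magnification.\<close>

lemma blow_diff:
  assumes g: "L-lipschitz_on M g" and "dist x b \<le> R k" "dist y b \<le> R k"
  shows "\<bar>blow g k x - blow g k y\<bar> \<le> L * dist x y + 2 * L / R k"
proof -
  note pos = s_pos[of k] R_pos[of k]
  have "dist (\<mu> k x) (\<mu> k y) \<le> dist (q k + (s k / R k) *\<^sub>R (x - b)) (q k + (s k / R k) *\<^sub>R (y - b)) + 2 * (s k / R k ^ 2)"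
    using mu(2)[OF assms(2)] mu(2)[OF assms(3)]
      dist_triangle[of "\<mu> k x" "\<mu> k y" "q k + (s k / R k) *\<^sub>R (x - b)"]
      dist_triangle[of "q k + (s k / R k) *\<^sub>R (x - b)" "\<mu> k y" "q k + (s k / R k) *\<^sub>R (y - b)"]
    by (simp only: dist_commute)
  also have "dist (q k + (s k / R k) *\<^sub>R (x - b)) (q k + (s k / R k) *\<^sub>R (y - b)) = s k / R k * dist x y"
    using pos by (simp add: dist_norm flip: scaleR_diff_right)
  finally have d: "dist (\<mu> k x) (\<mu> k y) \<le> s k / R k * dist x y + 2 * (s k / R k ^ 2)" .
  have "\<bar>blow g k x - blow g k y\<bar> = dist (R k / s k * g (\<mu> k x)) (R k / s k * g (\<mu> k y))"
    by (simp add: blow_def dist_real_def right_diff_distrib)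
  also have "\<dots> = R k / s k * dist (g (\<mu> k x)) (g (\<mu> k y))"
    using pos by (intro dist_mult_real) simp
  also have "\<dots> \<le> R k / s k * (L * dist (\<mu> k x) (\<mu> k y))"
    using pos lipschitz_onD[OF g mu(1) mu(1)] by (intro mult_left_mono) auto
  also have "\<dots> \<le> R k / s k * (L * (s k / R k * dist x y + 2 * (s k / R k ^ 2)))"
    using pos d lipschitz_on_nonneg[OF g] by (intro mult_left_mono) auto
  also have "\<dots> = L * dist x y + 2 * L / R k"
    using pos by (simp add: field_simps power2_eq_square)
  finally show ?thesis .
qed

lemma blow_diff_eventually:
  assumes "L-lipschitz_on M g"
  shows "\<forall>\<^sub>F j in sequentially. \<bar>blow g (prod_encode (i, j)) x - blow g (prod_encode (i, j)) y\<bar>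
    \<le> L * dist x y + 2 * L / R (prod_encode (i, j))"
  using eventually_R_encode[of "dist x b" i] eventually_R_encode[of "dist y b" i]
  by eventually_elim (rule blow_diff[OF assms])

lemma blow_base [simp]: "blow g k b = 0"
  by (simp add: blow_def)

lemma blow_Bseq:
  assumes g: "L-lipschitz_on M g"
  shows "Bseq (\<lambda>j. blow g (prod_encode (i, j)) y)"
proof (rule BfunI)
  have L: "0 \<le> L" using lipschitz_on_nonneg[OF g] .
  show "\<forall>\<^sub>F j in sequentially. norm (blow g (prod_encode (i, j)) y) \<le> L * dist y b + 2 * L"
    using blow_diff_eventually[OF g, of i y b]
  proof eventually_elim
    case (elim j)
    have "1 \<le> R (prod_encode (i, j))" by (simp add: R_def)
    then have "2 * L / R (prod_encode (i, j)) \<le> 2 * L / 1" using L by (intro divide_left_mono) auto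
    then show ?case using elim by simp
  qed
qed

lemma bounded_op_recover:
  "bounded_op 1 (Lip0 M a) (lip_norm M) (linf (Lip0 UNIV b) (lip_norm UNIV)) (linf_norm (lip_norm UNIV)) recover"
  unfolding bounded_op_def
proof (intro conjI ballI allI)
  fix g assume g: "g \<in> Lip0 M a"
  note lip = Lip0_lipschitz_on[of _ M a]
  have "(lip_norm M g)-lipschitz_on UNIV (\<lambda>y. recover g (i, y))" for i
  proof (rule lipschitz_onI)
    show "dist (recover g (i, x)) (recover g (i, y)) \<le> lip_norm M g * dist x y" for x y
      unfolding recover_def dist_real_def prod.case
      by (rule glim_abs_diff_le[OF blow_Bseq[OF lip[OF g]] blow_Bseq[OF lip[OF g]] inverse_R_encode
            blow_diff_eventually[OF lip[OF g]]])
  qed (rule lip_norm_nonneg[OF g])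
  moreover have "recover g (i, b) = 0" for i
    unfolding recover_def using glim_eq_limit[OF tendsto_const, of 0] by simp
  ultimately have "(\<lambda>y. recover g (i, y)) \<in> Lip0 UNIV b \<and> lip_norm UNIV (\<lambda>y. recover g (i, y)) \<le> 1 * lip_norm M g" for i
    by (auto simp: Lip0_def intro: lipschitz_imp_lip_norm_le[of "lip_norm M g"])
  then show "recover g \<in> linf (Lip0 UNIV b) (lip_norm UNIV)"
    "linf_norm (lip_norm UNIV) (recover g) \<le> 1 * lip_norm M g"
    using linfI by blast+
  show "recover (\<lambda>x. c * g x) = (\<lambda>y. c * recover g y)" for c
  proof
    fix p :: "nat \<times> 'a"
    obtain i y where p: "p = (i, y)" by (cases p)
    have "recover (\<lambda>x. c * g x) p = glim (\<lambda>j. c * blow g (prod_encode (i, j)) y)"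
      by (simp add: recover_def p blow_def algebra_simps)
    also have "\<dots> = c * recover g p"
      unfolding glim_cmult[OF blow_Bseq[OF lip[OF g]]] by (simp add: recover_def p)
    finally show "recover (\<lambda>x. c * g x) p = c * recover g p" .
  qed
  show "recover (g + h) = recover g + recover h" if h: "h \<in> Lip0 M a" for h
  proof
    fix p :: "nat \<times> 'a"
    obtain i y where p: "p = (i, y)" by (cases p)
    have "recover (g + h) p = glim (\<lambda>j. blow g (prod_encode (i, j)) y + blow h (prod_encode (i, j)) y)"
      by (simp add: recover_def p blow_def algebra_simps)
    also have "\<dots> = (recover g + recover h) p"
      unfolding glim_add[OF blow_Bseq[OF lip[OF g]] blow_Bseq[OF lip[OF h]]] by (simp add: recover_def p)
    finally show "recover (g + h) p = (recover g + recover h) p" .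
  qed
qed simp

text \<open>The \<open>+ 1\<close> leaves room for the displacement of \<open>\<mu> k y\<close>: it
  stays within \<open>s k\<close> of the centre, where the cutoff is 1 and \<open>glue F\<close> is
  the plain rescaled copy.\<close>

lemma glue_mu:
  assumes "dist y b + 1 \<le> R k"
  shows "\<exists>y'. dist y' y \<le> 1 / R k \<and> R k / s k * glue F (\<mu> k y) = F (fst (prod_decode k), y')"
proof -
  note pos = s_pos[of k] R_pos[of k]
  have R1: "1 \<le> R k" by (simp add: R_def)
  define y' where "y' = b + (R k / s k) *\<^sub>R (\<mu> k y - q k)"
  define z where "z = q k + (s k / R k) *\<^sub>R (y - b)"
  have z: "dist z (\<mu> k y) \<le> s k / R k ^ 2" unfolding z_def using mu(2)[of y k] assms by simp
  have "y' - y = (R k / s k) *\<^sub>R (\<mu> k y - z)"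
    using pos by (simp add: y'_def z_def algebra_simps)
  then have "dist y' y = R k / s k * dist z (\<mu> k y)"
    using pos by (simp add: dist_norm norm_minus_commute)
  also have "\<dots> \<le> R k / s k * (s k / R k ^ 2)" using pos z by (intro mult_left_mono) auto
  also have "\<dots> = 1 / R k" using pos by (simp add: power2_eq_square)
  finally have y': "dist y' y \<le> 1 / R k" .
  have "dist (q k) (\<mu> k y) \<le> dist (q k) z + dist z (\<mu> k y)" by (rule dist_triangle)
  also have "dist (q k) z = s k / R k * dist y b" using pos by (simp add: z_def dist_norm)
  also have "s k / R k * dist y b + dist z (\<mu> k y) \<le> s k / R k * (R k - 1) + s k / R k * 1"
  proof (intro add_mono mult_left_mono)
    have "s k / R k ^ 2 \<le> s k / R k"
      using pos R1 by (intro divide_left_mono) (auto simp: power2_eq_square)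
    then show "dist z (\<mu> k y) \<le> s k / R k * 1" using z by simp
  qed (use assms pos in auto)
  also have "\<dots> = s k" using pos by (simp add: field_simps)
  finally have near: "dist (q k) (\<mu> k y) \<le> s k" .
  then have "idx (\<mu> k y) = k" using idx_eq[of "\<mu> k y" k] pos by simp
  moreover have "cutoff k (\<mu> k y) = 1" using near pos by (simp add: cutoff_def min_def field_simps)
  ultimately have "R k / s k * glue F (\<mu> k y) = F (fst (prod_decode k), y')"
    using pos by (simp add: glue_def rescaled_def y'_def)
  then show ?thesis using y' by blast
qed

text \<open>On the image of \<open>embed\<close> the blow-ups do converge, so the generalized limit
  is an ordinary one. The constant \<open>glue F a\<close> cancels in \<open>blow\<close>, and the
  sampling errors at \<open>y\<close> and at \<open>b\<close> contribute \<open>L / R k\<close>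
  each.\<close>

lemma recover_embed:
  assumes F: "F \<in> linf (Lip0 UNIV b) (lip_norm UNIV)"
  shows "recover (embed F) = F"
proof
  fix p :: "nat \<times> 'a"
  obtain i y where p: "p = (i, y)" by (cases p)
  define L where "L = lip_norm UNIV (\<lambda>y. F (i, y))"
  have L: "L-lipschitz_on UNIV (\<lambda>y. F (i, y))"
    unfolding L_def by (rule Lip0_lipschitz_on[OF linf_component(1)[OF F]])
  have base: "F (i, b) = 0" using Lip0_base[OF linf_component(1)[OF F]] .
  have close: "\<bar>R k / s k * glue F (\<mu> k z) - F (i, z)\<bar> \<le> L / R k"
    if z: "dist z b + 1 \<le> R k" and k: "k = prod_encode (i, j)" for z k j
  proof -
    obtain y' where y': "dist y' z \<le> 1 / R k" "R k / s k * glue F (\<mu> k z) = F (fst (prod_decode k), y')"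
      using glue_mu[OF z] by blast
    have "\<bar>F (i, y') - F (i, z)\<bar> \<le> L * dist y' z"
      using lipschitz_onD[OF L, of y' z] by (simp add: dist_real_def)
    also have "\<dots> \<le> L * (1 / R k)" using y'(1) lipschitz_on_nonneg[OF L] by (rule mult_left_mono)
    finally show ?thesis using y'(2) k by simp
  qed
  have "(\<lambda>j. blow (embed F) (prod_encode (i, j)) y - F (i, y)) \<longlonglongrightarrow> 0"
  proof (rule Lim_null_comparison[OF _ inverse_R_encode])
    show "\<forall>\<^sub>F j in sequentially. norm (blow (embed F) (prod_encode (i, j)) y - F (i, y)) \<le> 2 * L / R (prod_encode (i, j))"
      using eventually_R_encode[of "dist y b + 1" i]
    proof eventually_elim
      case (elim j)
      define k where "k = prod_encode (i, j)"
      have "blow (embed F) k y = R k / s k * glue F (\<mu> k y) - R k / s k * glue F (\<mu> k b)"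
        by (simp add: blow_def embed_def mu(1) algebra_simps)
      moreover have "dist y b + 1 \<le> R k" "dist b b + 1 \<le> R k"
        using elim by (simp_all add: k_def R_def)
      ultimately have "\<bar>blow (embed F) k y - F (i, y)\<bar> \<le> L / R k + L / R k"
        using close[of y k j, OF _ k_def] close[of b k j, OF _ k_def] unfolding base by linarith
      then show ?case by (simp add: k_def)
    qed
  qed
  then have "(\<lambda>j. blow (embed F) (prod_encode (i, j)) y) \<longlonglongrightarrow> F (i, y)" by (simp add: LIM_zero_iff)
  then show "recover (embed F) p = F p" by (simp add: p recover_def glim_eq_limit)
qed

end

section \<open>Application of the decomposition method\<close>

theorem Lip0_isomorphic_linf:
  fixes M :: "(real ^ 'n) set" and a b :: "real ^ 'n"
  assumes M: "\<not> porous_in UNIV M" and a: "a \<in> M"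
  shows "isomorphic_spaces (Lip0 M a) (lip_norm M)
    (linf (Lip0 UNIV b) (lip_norm UNIV)) (linf_norm (lip_norm UNIV))"
proof -
  let ?X = "Lip0 (UNIV :: (real ^ 'n) set) b" and ?n = "lip_norm (UNIV :: (real ^ 'n) set)"
  have "\<exists>q s. (\<forall>n::nat. dense_ball M (1 / real (Suc n) ^ 2) (q n) (s n)) \<and>
    (\<forall>i j. i \<noteq> j \<longrightarrow> cball (q i) (2 * s i) \<inter> cball (q j) (2 * s j) = {})"
    by (rule disjoint_dense_balls[OF not_porous_imp_rich[OF M]]) (simp del: of_nat_Suc)
  then obtain q s where "\<And>n::nat. dense_ball M (1 / real (Suc n) ^ 2) (q n) (s n)"
    "\<And>i j. i \<noteq> j \<Longrightarrow> cball (q i) (2 * s i) \<inter> cball (q j) (2 * s j) = {}" by blast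
  then interpret blow_up_balls M a b q s by unfold_locales (use a in auto)
  obtain K L A B where A: "bounded_op K (Lip0 M a) (lip_norm M) ?X ?n A"
    and B: "bounded_op L ?X ?n (Lip0 M a) (lip_norm M) B" and BA: "\<And>f. f \<in> Lip0 M a \<Longrightarrow> B (A f) = f"
    using Lip0_complemented_in_UNIV[OF a, of b] by blast
  \<comment> \<open>Component 0 of the sum is a complemented copy of the Lipschitz space of the
    whole space, in which \<open>Lip0 M a\<close> is complemented in turn.\<close>
  define inj where "inj f = (\<lambda>(i, x). if i = (0::nat) then f x else 0)" for f :: "real ^ 'n \<Rightarrow> real"
  define proj where "proj F = (\<lambda>x. F (0, x))" for F :: "nat \<times> (real ^ 'n) \<Rightarrow> real"
  have inj_mem: "inj f \<in> linf ?X ?n \<and> linf_norm ?n (inj f) \<le> ?n f" if f: "f \<in> ?X" for f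
  proof -
    have "(\<lambda>x. inj f (i, x)) \<in> ?X \<and> ?n (\<lambda>x. inj f (i, x)) \<le> ?n f" for i
      using f fun_spaceD(1)[OF fun_space_Lip0[of "UNIV :: (real ^ 'n) set" b]] lip_norm_nonneg[OF f]
        lipschitz_imp_lip_norm_le[OF lipschitz_on_constant[of "UNIV :: (real ^ 'n) set" "0 :: real"]]
      by (cases "i = 0") (simp_all add: inj_def zero_fun_def)
    then show ?thesis using linfI by blast
  qed
  have inj: "bounded_op 1 ?X ?n (linf ?X ?n) (linf_norm ?n) inj"
    unfolding bounded_op_def using inj_mem by (auto simp: inj_def fun_eq_iff)
  have proj: "bounded_op 1 (linf ?X ?n) (linf_norm ?n) ?X ?n proj"
    unfolding bounded_op_def proj_def using linf_component by auto
  show ?thesis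
  proof (rule pelczynski_decomposition[OF fun_space_Lip0 fun_space_Lip0 bounded_op_embed
        bounded_op_recover recover_embed bounded_op_comp[OF inj A] bounded_op_comp[OF B proj]])
    show "B (proj (inj (A f))) = f" if "f \<in> Lip0 M a" for f
      using BA[OF that] by (simp add: inj_def proj_def)
  qed
qed

lemma not_porous_UNIV: "\<not> porous_in UNIV (UNIV :: (real ^ 'n) set)"
proof
  assume "porous_in UNIV (UNIV :: (real ^ 'n) set)"
  then obtain c :: real where "0 < c" and c: "\<And>(p :: real ^ 'n) r. 0 < r \<Longrightarrow> \<exists>x. cball x (c * r) \<subseteq> cball p r - UNIV"
    unfolding porous_in_UNIV_iff by blast
  obtain x :: "real ^ 'n" where "cball x (c * 1) \<subseteq> {}" using c[of 1 0] by auto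
  then show False using \<open>0 < c\<close> by simp
qed

theorem theorem3p7:
  fixes M :: "(real ^ 'n) set" and a b :: "real ^ 'n"
  assumes "\<not> porous_in UNIV M"
    and "a \<in> M"
  shows "linearly_isomorphic (Lip0 M a) (lip_norm M) (Lip0 UNIV b) (lip_norm UNIV)"
  by (rule isomorphic_spaces_imp_linearly_isomorphic, rule isomorphic_spaces_trans)
    (rule Lip0_isomorphic_linf[OF assms, of b],
     rule isomorphic_spaces_sym, rule Lip0_isomorphic_linf[OF not_porous_UNIV UNIV_I])

end
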